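(* Let $k$ be a number field, let $p$ be a prime number, let $l$ be a positive integer and put $q=p^l$. Let $\mathcal{G}$ be a commutative algebraic group defined over $k$ which is isomorphic to a semidirect product $\mathbb{G}_m\rtimes \mathcal{E}$, where $\mathbb{G}_m$ is the multiplicative group over $k$ and $\mathcal{E}$ is an elliptic curve defined over $k$. Then the local-global divisibility by $q$ holds in $\mathcal{G}$ over $k$ if and only if the local-global divisibility by $q$ holds both in $\mathbb{G}_m$ over $k$ and in $\mathcal{E}$ over $k$.
   Context: For a place $v$ of $k$, $k_v$ denotes the completion of $k$ at $v$. For a commutative algebraic group $\mathcal{H}$ over $k$ (written additively) and a positive integer $q$, one says that the local-global divisibility by $q$ holds in $\mathcal{H}$ over $k$ if the following is true: for every point $P\in\mathcal{H}(k)$ such that for all but finitely many places $v$ of $k$ there exists $D_v\in\mathcal{H}(k_v)$ with $P=qD_v$, there exists $D\in\mathcal{H}(k)$ with $P=qD$. The semidirect product $\mathbb{G}_m\rtimes\mathcal{E}$ is taken with respect to a homomorphism $\varphi:\mathcal{E}\to\mathrm{Aut}(\mathbb{G}_m)$, where $\mathrm{Aut}(\mathbb{G}_m)$ consists of the identity and the inversion $g\mapsto g^{-1}$; the group law is $(g_1,P_1)*(g_2,P_2)=(g_1\,\varphi(P_1)(g_2),\,P_1+P_2)$. *)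

theory Defs
  imports Complex_Main "HOL-Algebra.Algebra" "HOL-Computational_Algebra.Primes"
begin

section \<open>Number fields, places, completions\<close>

definition number_field :: "'a ring \<Rightarrow> bool" where
  "number_field k \<longleftrightarrow> field k \<and>
     (\<forall>n::nat. n > 0 \<longrightarrow> add_pow k n \<one>\<^bsub>k\<^esub> \<noteq> \<zero>\<^bsub>k\<^esub>) \<and>
     ring.finite_dimension k (generate_field k {}) (carrier k)"
  \<comment> \<open>In characteristic 0 the prime field \<open>generate_field k {}\<close> is the field of rational numbers.\<close>

definition absolute_value :: "'a ring \<Rightarrow> ('a \<Rightarrow> real) \<Rightarrow> bool" where
  "absolute_value k v \<longleftrightarrow>
     (\<forall>x\<in>carrier k. v x \<ge> 0 \<and> (v x = 0 \<longleftrightarrow> x = \<zero>\<^bsub>k\<^esub>)) \<and>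
     (\<forall>x\<in>carrier k. \<forall>y\<in>carrier k. v (x \<otimes>\<^bsub>k\<^esub> y) = v x * v y) \<and>
     (\<forall>x\<in>carrier k. \<forall>y\<in>carrier k. v (x \<oplus>\<^bsub>k\<^esub> y) \<le> v x + v y)"

definition nontrivial_absolute_value :: "'a ring \<Rightarrow> ('a \<Rightarrow> real) \<Rightarrow> bool" where
  "nontrivial_absolute_value k v \<longleftrightarrow> absolute_value k v \<and>
     (\<exists>x\<in>carrier k. x \<noteq> \<zero>\<^bsub>k\<^esub> \<and> v x \<noteq> 1)"

definition absolute_value_equiv :: "'a ring \<Rightarrow> (('a \<Rightarrow> real) \<times> ('a \<Rightarrow> real)) set" where
  "absolute_value_equiv k = {(v, w).
     nontrivial_absolute_value k v \<and> nontrivial_absolute_value k w \<and>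
     (\<exists>s>0. \<forall>x\<in>carrier k. w x = v x powr s)}"

definition places :: "'a ring \<Rightarrow> ('a \<Rightarrow> real) set set" where
  "places k = {v. nontrivial_absolute_value k v} // absolute_value_equiv k"

text \<open>The completion at a place is the ring of Cauchy sequences modulo null sequences. Both
  notions are the same for all absolute values in the class \<open>V\<close>, so quantifying over \<open>w \<in> V\<close>
  only avoids choosing a representative.\<close>

definition cauchy_ring :: "'a ring \<Rightarrow> ('a \<Rightarrow> real) set \<Rightarrow> (nat \<Rightarrow> 'a) ring" where
  "cauchy_ring k V =
     \<lparr> carrier = {s. (\<forall>n. s n \<in> carrier k) \<and>
         (\<forall>w\<in>V. \<forall>\<epsilon>>0. \<exists>N. \<forall>m\<ge>N. \<forall>n\<ge>N. w (s m \<ominus>\<^bsub>k\<^esub> s n) < \<epsilon>)},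
       monoid.mult = (\<lambda>s t n. s n \<otimes>\<^bsub>k\<^esub> t n),
       one = (\<lambda>n. \<one>\<^bsub>k\<^esub>),
       ring.zero = (\<lambda>n. \<zero>\<^bsub>k\<^esub>),
       add = (\<lambda>s t n. s n \<oplus>\<^bsub>k\<^esub> t n) \<rparr>"

definition null_seqs :: "'a ring \<Rightarrow> ('a \<Rightarrow> real) set \<Rightarrow> (nat \<Rightarrow> 'a) set" where
  "null_seqs k V =
     {s \<in> carrier (cauchy_ring k V). \<forall>w\<in>V. (\<lambda>n. w (s n)) \<longlonglongrightarrow> 0}"

definition completion :: "'a ring \<Rightarrow> ('a \<Rightarrow> real) set \<Rightarrow> (nat \<Rightarrow> 'a) set ring" where
  "completion k V = cauchy_ring k V Quot null_seqs k V"

definition completion_emb :: "'a ring \<Rightarrow> ('a \<Rightarrow> real) set \<Rightarrow> 'a \<Rightarrow> (nat \<Rightarrow> 'a) set" where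
  "completion_emb k V x = null_seqs k V +>\<^bsub>cauchy_ring k V\<^esub> (\<lambda>n. x)"


section \<open>Extension fields\<close>

text \<open>An extension of \<open>k\<close> is a field together with an embedding of \<open>k\<close>. All extensions have
  their elements in the type \<open>(nat \<Rightarrow> 'a) set\<close> of the completions. For an infinite field \<open>k\<close> in \<open>'a\<close>
  this type has at least the cardinality of the continuum and strictly more elements than \<open>k\<close>, so
  that it carries algebraically closed extensions of \<open>k\<close> of infinite transcendence degree. Thus
  a condition on the points over all these extensions is a condition on the geometric points, and
  (in characteristic 0, where algebraic groups are reduced) on the varieties themselves.\<close>

type_synonym 'a extension = "(nat \<Rightarrow> 'a) set ring \<times> ('a \<Rightarrow> (nat \<Rightarrow> 'a) set)"

definition field_extension :: "'a ring \<Rightarrow> 'a extension \<Rightarrow> bool" where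
  "field_extension k e \<longleftrightarrow> field (fst e) \<and> snd e \<in> ring_hom k (fst e)"

text \<open>The trivial extension: \<open>k\<close> itself, copied into the common type by means of singletons.\<close>

definition base_extension :: "'a ring \<Rightarrow> 'a extension" where
  "base_extension k = (image_ring (\<lambda>x. {\<lambda>n. x}) k, \<lambda>x. {\<lambda>n. x})"

definition completion_extension :: "'a ring \<Rightarrow> ('a \<Rightarrow> real) set \<Rightarrow> 'a extension" where
  "completion_extension k V = (completion k V, completion_emb k V)"


section \<open>Quasi-projective varieties\<close>

text \<open>Varieties are locally closed subsets of products of projective spaces; this covers all
  algebraic groups, since these are quasi-projective. The list \<open>ds\<close> gives
  the dimensions of the factors, and \<open>(i, j)\<close> is the index of the \<open>j\<close>-th homogeneous coordinate
  on the \<open>i\<close>-th factor.\<close>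

definition coord_index :: "nat list \<Rightarrow> (nat \<times> nat) set" where
  "coord_index ds = (SIGMA i:{..<length ds}. {..ds ! i})"

definition hom_coords :: "nat list \<Rightarrow> 'u ring \<Rightarrow> (nat \<times> nat \<Rightarrow> 'u) set" where
  "hom_coords ds L = {x \<in> coord_index ds \<rightarrow>\<^sub>E carrier L.
     \<forall>i<length ds. \<exists>j\<le>ds ! i. x (i, j) \<noteq> \<zero>\<^bsub>L\<^esub>}"

definition proj_point :: "nat list \<Rightarrow> 'u ring \<Rightarrow> (nat \<times> nat \<Rightarrow> 'u) \<Rightarrow> (nat \<times> nat \<Rightarrow> 'u) set" where
  "proj_point ds L x = {y \<in> hom_coords ds L.
     \<exists>c. (\<forall>i<length ds. c i \<in> carrier L - {\<zero>\<^bsub>L\<^esub>}) \<and>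
         (\<forall>(i, j)\<in>coord_index ds. y (i, j) = c i \<otimes>\<^bsub>L\<^esub> x (i, j))}"

type_synonym 'a mpoly = "(nat \<times> nat) multiset \<Rightarrow> 'a"

type_synonym 'a point = "(nat \<times> nat \<Rightarrow> (nat \<Rightarrow> 'a) set) set"

text \<open>Polynomials over \<open>k\<close> that are homogeneous of degree \<open>d i\<close> in the coordinates of the
  \<open>i\<close>-th factor.\<close>

definition multihomogeneous :: "'a ring \<Rightarrow> nat list \<Rightarrow> (nat \<Rightarrow> nat) \<Rightarrow> 'a mpoly set" where
  "multihomogeneous k ds d = {F \<in> ring.indexed_pset k (coord_index ds) (carrier k).
     \<forall>m. F m \<noteq> \<zero>\<^bsub>k\<^esub> \<longrightarrow> (\<forall>i<length ds. size (filter_mset (\<lambda>u. fst u = i) m) = d i)}"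

definition poly_eval :: "'a ring \<Rightarrow> 'a extension \<Rightarrow> 'a mpoly \<Rightarrow>
    (nat \<times> nat \<Rightarrow> (nat \<Rightarrow> 'a) set) \<Rightarrow> (nat \<Rightarrow> 'a) set" where
  "poly_eval k e F x = (\<Oplus>\<^bsub>fst e\<^esub>m\<in>{m. F m \<noteq> \<zero>\<^bsub>k\<^esub>}.
     snd e (F m) \<otimes>\<^bsub>fst e\<^esub> (\<Otimes>\<^bsub>fst e\<^esub>u\<in>set_mset m. x u [^]\<^bsub>fst e\<^esub> count m u))"

text \<open>All polynomials in \<open>equations\<close> vanish on the variety; each set in \<open>inequations\<close> defines the
  open subset where not all of its polynomials vanish, and the variety lies in all of these.\<close>

record 'a variety =
  dims :: "nat list"
  equations :: "'a mpoly set"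
  inequations :: "'a mpoly set set"

definition is_variety :: "'a ring \<Rightarrow> 'a variety \<Rightarrow> bool" where
  "is_variety k S \<longleftrightarrow> finite (inequations S) \<and>
     (\<forall>F \<in> equations S \<union> (\<Union>U\<in>inequations S. U). \<exists>d. F \<in> multihomogeneous k (dims S) d)"

definition var_points :: "'a ring \<Rightarrow> 'a variety \<Rightarrow> 'a extension \<Rightarrow> 'a point set" where
  "var_points k S e = proj_point (dims S) (fst e) ` {x \<in> hom_coords (dims S) (fst e).
     (\<forall>F\<in>equations S. poly_eval k e F x = \<zero>\<^bsub>fst e\<^esub>) \<and>
     (\<forall>U\<in>inequations S. \<exists>F\<in>U. poly_eval k e F x \<noteq> \<zero>\<^bsub>fst e\<^esub>)}"

text \<open>A morphism over \<open>k\<close> is given, locally on the source, by multihomogeneous polynomials over \<open>k\<close>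
  which for each factor of the target have a common multidegree. The set \<open>\<Phi>\<close> collects the local
  expressions. One of them describes the morphism at the points where, for each factor of
  the target, its values do not all vanish.\<close>

definition eval_chart :: "'a ring \<Rightarrow> 'a extension \<Rightarrow> nat list \<Rightarrow> (nat \<times> nat \<Rightarrow> 'a mpoly) \<Rightarrow>
    (nat \<times> nat \<Rightarrow> (nat \<Rightarrow> 'a) set) \<Rightarrow> nat \<times> nat \<Rightarrow> (nat \<Rightarrow> 'a) set" where
  "eval_chart k e ds A x = (\<lambda>u\<in>coord_index ds. poly_eval k e (A u) x)"

definition regular_map :: "'a ring \<Rightarrow> 'a variety \<Rightarrow> 'a variety \<Rightarrow>
    ('a extension \<Rightarrow> 'a point \<Rightarrow> 'a point) \<Rightarrow> bool" where
  "regular_map k S T f \<longleftrightarrow>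
     (\<forall>e. field_extension k e \<longrightarrow> f e ` var_points k S e \<subseteq> var_points k T e) \<and>
     (\<exists>\<Phi>. (\<forall>A\<in>\<Phi>. \<forall>i<length (dims T). \<exists>d. \<forall>j\<le>dims T ! i.
             A (i, j) \<in> multihomogeneous k (dims S) d) \<and>
          (\<forall>e. field_extension k e \<longrightarrow> (\<forall>P\<in>var_points k S e. \<forall>x\<in>P.
             (\<exists>A\<in>\<Phi>. eval_chart k e (dims T) A x \<in> hom_coords (dims T) (fst e)) \<and>
             (\<forall>A\<in>\<Phi>. eval_chart k e (dims T) A x \<in> hom_coords (dims T) (fst e) \<longrightarrow>
                f e P = proj_point (dims T) (fst e) (eval_chart k e (dims T) A x)))))"

text \<open>The inclusion of \<open>S(k)\<close> in the points over an extension of \<open>k\<close>.\<close>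

definition base_change :: "'a ring \<Rightarrow> 'a variety \<Rightarrow> 'a extension \<Rightarrow> 'a point \<Rightarrow> 'a point" where
  "base_change k S e P = (\<Union>x\<in>P. proj_point (dims S) (fst e)
     (\<lambda>u\<in>coord_index (dims S).
        snd e (inv_into (carrier k) (snd (base_extension k)) (x u))))"

definition shift_poly :: "'a ring \<Rightarrow> nat \<Rightarrow> 'a mpoly \<Rightarrow> 'a mpoly" where
  "shift_poly k n F = (\<lambda>m. if \<forall>u\<in>#m. n \<le> fst u
     then F (image_mset (\<lambda>(i, j). (i - n, j)) m) else \<zero>\<^bsub>k\<^esub>)"

definition var_prod :: "'a ring \<Rightarrow> 'a variety \<Rightarrow> 'a variety \<Rightarrow> 'a variety" where
  "var_prod k S T = (let n = length (dims S) in
     \<lparr> dims = dims S @ dims T,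
       equations = equations S \<union> shift_poly k n ` equations T,
       inequations = inequations S \<union> (\<lambda>U. shift_poly k n ` U) ` inequations T \<rparr>)"

definition pair_point :: "'a variety \<Rightarrow> 'a variety \<Rightarrow> 'a point \<Rightarrow> 'a point \<Rightarrow> 'a point" where
  "pair_point S T P Q = {\<lambda>(i, j)\<in>coord_index (dims S @ dims T).
     if i < length (dims S) then x (i, j) else y (i - length (dims S), j) | x y. x \<in> P \<and> y \<in> Q}"

definition fst_point :: "'a variety \<Rightarrow> 'a variety \<Rightarrow> 'a point \<Rightarrow> 'a point" where
  "fst_point S T R = (\<lambda>z. \<lambda>u\<in>coord_index (dims S). z u) ` R"

definition snd_point :: "'a variety \<Rightarrow> 'a variety \<Rightarrow> 'a point \<Rightarrow> 'a point" where
  "snd_point S T R = (\<lambda>z. \<lambda>(i, j)\<in>coord_index (dims T). z (i + length (dims S), j)) ` R"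


section \<open>Algebraic groups\<close>

record 'a alg_group =
  gvar :: "'a variety"
  grp :: "'a extension \<Rightarrow> 'a point monoid"

text \<open>Since multiplication and inversion are given by polynomials over \<open>k\<close>, the group structures
  over the various extensions are compatible with each other.\<close>

definition algebraic_group :: "'a ring \<Rightarrow> 'a alg_group \<Rightarrow> bool" where
  "algebraic_group k G \<longleftrightarrow> is_variety k (gvar G) \<and>
     (\<forall>e. field_extension k e \<longrightarrow>
        group (grp G e) \<and> carrier (grp G e) = var_points k (gvar G) e) \<and>
     regular_map k (var_prod k (gvar G) (gvar G)) (gvar G)
       (\<lambda>e R. fst_point (gvar G) (gvar G) R \<otimes>\<^bsub>grp G e\<^esub> snd_point (gvar G) (gvar G) R) \<and>
     regular_map k (gvar G) (gvar G) (\<lambda>e P. inv\<^bsub>grp G e\<^esub> P)"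

definition commutative_algebraic_group :: "'a ring \<Rightarrow> 'a alg_group \<Rightarrow> bool" where
  "commutative_algebraic_group k G \<longleftrightarrow> algebraic_group k G \<and>
     (\<forall>e. field_extension k e \<longrightarrow> comm_group (grp G e))"

definition isomorphic_over :: "'a ring \<Rightarrow> 'a alg_group \<Rightarrow> 'a alg_group \<Rightarrow> bool" where
  "isomorphic_over k G H \<longleftrightarrow> (\<exists>f g.
     regular_map k (gvar G) (gvar H) f \<and> regular_map k (gvar H) (gvar G) g \<and>
     (\<forall>e. field_extension k e \<longrightarrow>
        f e \<in> hom (grp G e) (grp H e) \<and>
        (\<forall>P\<in>var_points k (gvar G) e. g e (f e P) = P) \<and>
        (\<forall>Q\<in>var_points k (gvar H) e. f e (g e Q) = Q)))"

text \<open>The group laws are written multiplicatively, so \<open>D [^] q\<close> is \<open>q D\<close>.\<close>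

definition local_global_divisibility :: "'a ring \<Rightarrow> 'a alg_group \<Rightarrow> nat \<Rightarrow> bool" where
  "local_global_divisibility k H q \<longleftrightarrow>
     (\<forall>P\<in>carrier (grp H (base_extension k)).
        finite {V \<in> places k. \<not> (\<exists>D\<in>carrier (grp H (completion_extension k V)).
            base_change k (gvar H) (completion_extension k V) P
              = D [^]\<^bsub>grp H (completion_extension k V)\<^esub> q)} \<longrightarrow>
        (\<exists>D\<in>carrier (grp H (base_extension k)). P = D [^]\<^bsub>grp H (base_extension k)\<^esub> q))"


section \<open>The multiplicative group\<close>

definition coord_vec :: "'u list \<Rightarrow> nat \<times> nat \<Rightarrow> 'u" where
  "coord_vec xs = (\<lambda>(i, j)\<in>{0} \<times> {..<length xs}. xs ! j)"

text \<open>The open subset \<open>x\<^sub>0 x\<^sub>1 \<noteq> 0\<close> of the projective line, where \<open>[x\<^sub>0 : x\<^sub>1]\<close> stands for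
  \<open>x\<^sub>0 / x\<^sub>1\<close>, with coordinatewise multiplication.\<close>

definition Gm_var :: "'a ring \<Rightarrow> 'a variety" where
  "Gm_var k = \<lparr> dims = [1], equations = {},
     inequations = {{\<lambda>m. if m = {#(0, 0), (0, 1)#} then \<one>\<^bsub>k\<^esub> else \<zero>\<^bsub>k\<^esub>}} \<rparr>"

definition Gm :: "'a ring \<Rightarrow> 'a alg_group" where
  "Gm k = \<lparr> gvar = Gm_var k,
     grp = (\<lambda>e.
       \<lparr> carrier = var_points k (Gm_var k) e,
         monoid.mult = (\<lambda>P Q. {\<lambda>u\<in>coord_index [1]. x u \<otimes>\<^bsub>fst e\<^esub> y u | x y. x \<in> P \<and> y \<in> Q}),
         one = proj_point [1] (fst e) (coord_vec [\<one>\<^bsub>fst e\<^esub>, \<one>\<^bsub>fst e\<^esub>]) \<rparr>) \<rparr>"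


section \<open>Elliptic curves\<close>

text \<open>Elliptic curves are given by Weierstrass equations
  \<open>y\<^sup>2 + a\<^sub>1xy + a\<^sub>3y = x\<^sup>3 + a\<^sub>2x\<^sup>2 + a\<^sub>4x + a\<^sub>6\<close> with nonzero discriminant.\<close>

record 'a weierstrass =
  wa1 :: 'a
  wa2 :: 'a
  wa3 :: 'a
  wa4 :: 'a
  wa6 :: 'a

definition weierstrass_disc :: "'a ring \<Rightarrow> 'a weierstrass \<Rightarrow> 'a" where
  "weierstrass_disc k W = (let
       a1 = wa1 W; a2 = wa2 W; a3 = wa3 W; a4 = wa4 W; a6 = wa6 W;
       b2 = a1 \<otimes>\<^bsub>k\<^esub> a1 \<oplus>\<^bsub>k\<^esub> add_pow k (4::nat) a2;
       b4 = add_pow k (2::nat) a4 \<oplus>\<^bsub>k\<^esub> a1 \<otimes>\<^bsub>k\<^esub> a3;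
       b6 = a3 \<otimes>\<^bsub>k\<^esub> a3 \<oplus>\<^bsub>k\<^esub> add_pow k (4::nat) a6;
       b8 = a1 \<otimes>\<^bsub>k\<^esub> a1 \<otimes>\<^bsub>k\<^esub> a6 \<oplus>\<^bsub>k\<^esub> add_pow k (4::nat) (a2 \<otimes>\<^bsub>k\<^esub> a6)
          \<ominus>\<^bsub>k\<^esub> a1 \<otimes>\<^bsub>k\<^esub> a3 \<otimes>\<^bsub>k\<^esub> a4 \<oplus>\<^bsub>k\<^esub> a2 \<otimes>\<^bsub>k\<^esub> a3 \<otimes>\<^bsub>k\<^esub> a3 \<ominus>\<^bsub>k\<^esub> a4 \<otimes>\<^bsub>k\<^esub> a4
     in \<ominus>\<^bsub>k\<^esub> (b2 \<otimes>\<^bsub>k\<^esub> b2 \<otimes>\<^bsub>k\<^esub> b8) \<ominus>\<^bsub>k\<^esub> add_pow k (8::nat) (b4 \<otimes>\<^bsub>k\<^esub> b4 \<otimes>\<^bsub>k\<^esub> b4)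
          \<ominus>\<^bsub>k\<^esub> add_pow k (27::nat) (b6 \<otimes>\<^bsub>k\<^esub> b6) \<oplus>\<^bsub>k\<^esub> add_pow k (9::nat) (b2 \<otimes>\<^bsub>k\<^esub> b4 \<otimes>\<^bsub>k\<^esub> b6))"

definition elliptic_curve :: "'a ring \<Rightarrow> 'a weierstrass \<Rightarrow> bool" where
  "elliptic_curve k W \<longleftrightarrow> {wa1 W, wa2 W, wa3 W, wa4 W, wa6 W} \<subseteq> carrier k \<and>
     weierstrass_disc k W \<noteq> \<zero>\<^bsub>k\<^esub>"

text \<open>\<open>Y\<^sup>2Z + a\<^sub>1XYZ + a\<^sub>3YZ\<^sup>2 - X\<^sup>3 - a\<^sub>2X\<^sup>2Z - a\<^sub>4XZ\<^sup>2 - a\<^sub>6Z\<^sup>3\<close>\<close>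

definition weierstrass_poly :: "'a ring \<Rightarrow> 'a weierstrass \<Rightarrow> 'a mpoly" where
  "weierstrass_poly k W = (let cX = (0, 0); cY = (0, 1); cZ = (0, 2) in
     (\<lambda>m. if m = {#cY, cY, cZ#} then \<one>\<^bsub>k\<^esub>
       else if m = {#cX, cY, cZ#} then wa1 W
       else if m = {#cY, cZ, cZ#} then wa3 W
       else if m = {#cX, cX, cX#} then \<ominus>\<^bsub>k\<^esub> \<one>\<^bsub>k\<^esub>
       else if m = {#cX, cX, cZ#} then \<ominus>\<^bsub>k\<^esub> wa2 W
       else if m = {#cX, cZ, cZ#} then \<ominus>\<^bsub>k\<^esub> wa4 W
       else if m = {#cZ, cZ, cZ#} then \<ominus>\<^bsub>k\<^esub> wa6 W
       else \<zero>\<^bsub>k\<^esub>))"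

definition elliptic_var :: "'a ring \<Rightarrow> 'a weierstrass \<Rightarrow> 'a variety" where
  "elliptic_var k W =
     \<lparr> dims = [2], equations = {weierstrass_poly k W}, inequations = {} \<rparr>"

definition infinity_point :: "'u ring \<Rightarrow> (nat \<times> nat \<Rightarrow> 'u) set" where
  "infinity_point L = proj_point [2] L (coord_vec [\<zero>\<^bsub>L\<^esub>, \<one>\<^bsub>L\<^esub>, \<zero>\<^bsub>L\<^esub>])"

definition affine_point :: "'u ring \<Rightarrow> 'u \<Rightarrow> 'u \<Rightarrow> (nat \<times> nat \<Rightarrow> 'u) set" where
  "affine_point L x y = proj_point [2] L (coord_vec [x, y, \<one>\<^bsub>L\<^esub>])"

definition affine_coords :: "'u ring \<Rightarrow> (nat \<times> nat \<Rightarrow> 'u) set \<Rightarrow> 'u \<times> 'u" where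
  "affine_coords L P =
     (THE (x, y). x \<in> carrier L \<and> y \<in> carrier L \<and> P = affine_point L x y)"

text \<open>The chord and tangent law: for two affine points \<open>P\<close> and \<open>Q\<close> that are not
  opposite to each other, \<open>y = lam x + nu\<close> is the line through \<open>P\<close> and \<open>Q\<close> (the tangent if
  \<open>P = Q\<close>), which meets the curve also in the opposite of the sum.\<close>

definition elliptic_add :: "'a weierstrass \<Rightarrow> 'a extension \<Rightarrow> 'a point \<Rightarrow> 'a point \<Rightarrow> 'a point" where
  "elliptic_add W e P Q = (let L = fst e in
     if P = infinity_point L then Q
     else if Q = infinity_point L then P
     else let
       a1 = snd e (wa1 W); a2 = snd e (wa2 W); a3 = snd e (wa3 W); a4 = snd e (wa4 W);
       (x1, y1) = affine_coords L P;
       (x2, y2) = affine_coords L Q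
     in if x1 = x2 \<and> y1 \<oplus>\<^bsub>L\<^esub> y2 \<oplus>\<^bsub>L\<^esub> a1 \<otimes>\<^bsub>L\<^esub> x2 \<oplus>\<^bsub>L\<^esub> a3 = \<zero>\<^bsub>L\<^esub> then infinity_point L
     else let
       lam = (if x1 \<noteq> x2
         then (y2 \<ominus>\<^bsub>L\<^esub> y1) \<otimes>\<^bsub>L\<^esub> inv\<^bsub>L\<^esub> (x2 \<ominus>\<^bsub>L\<^esub> x1)
         else (add_pow L (3::nat) (x1 \<otimes>\<^bsub>L\<^esub> x1) \<oplus>\<^bsub>L\<^esub> add_pow L (2::nat) (a2 \<otimes>\<^bsub>L\<^esub> x1) \<oplus>\<^bsub>L\<^esub> a4 \<ominus>\<^bsub>L\<^esub> a1 \<otimes>\<^bsub>L\<^esub> y1)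
              \<otimes>\<^bsub>L\<^esub> inv\<^bsub>L\<^esub> (add_pow L (2::nat) y1 \<oplus>\<^bsub>L\<^esub> a1 \<otimes>\<^bsub>L\<^esub> x1 \<oplus>\<^bsub>L\<^esub> a3));
       nu = y1 \<ominus>\<^bsub>L\<^esub> lam \<otimes>\<^bsub>L\<^esub> x1;
       x3 = lam \<otimes>\<^bsub>L\<^esub> lam \<oplus>\<^bsub>L\<^esub> a1 \<otimes>\<^bsub>L\<^esub> lam \<ominus>\<^bsub>L\<^esub> a2 \<ominus>\<^bsub>L\<^esub> x1 \<ominus>\<^bsub>L\<^esub> x2
     in affine_point L x3 (\<ominus>\<^bsub>L\<^esub> ((lam \<oplus>\<^bsub>L\<^esub> a1) \<otimes>\<^bsub>L\<^esub> x3) \<ominus>\<^bsub>L\<^esub> nu \<ominus>\<^bsub>L\<^esub> a3))"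

definition elliptic_group :: "'a ring \<Rightarrow> 'a weierstrass \<Rightarrow> 'a alg_group" where
  "elliptic_group k W = \<lparr> gvar = elliptic_var k W,
     grp = (\<lambda>e.
       \<lparr> carrier = var_points k (elliptic_var k W) e,
         monoid.mult = elliptic_add W e,
         one = infinity_point (fst e) \<rparr>) \<rparr>"


section \<open>Semidirect products\<close>

text \<open>\<open>Aut(\<bbbG>\<^sub>m)\<close>, the group of automorphisms of \<open>\<bbbG>\<^sub>m\<close> as an algebraic group, consists of the
  identity and the inversion.\<close>

definition Aut_Gm :: "'a ring \<Rightarrow> 'a extension \<Rightarrow> ('a point \<Rightarrow> 'a point) monoid" where
  "Aut_Gm k e = (AutoGroup (grp (Gm k) e)) \<lparr> carrier :=
     {\<lambda>g\<in>carrier (grp (Gm k) e). g,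
      \<lambda>g\<in>carrier (grp (Gm k) e). inv\<^bsub>grp (Gm k) e\<^esub> g} \<rparr>"

text \<open>Homomorphisms \<open>H \<rightarrow> Aut(\<bbbG>\<^sub>m)\<close> defined over \<open>k\<close>; that \<open>\<phi>\<close> is algebraic means that
  \<open>(P, g) \<mapsto> \<phi>(P)(g)\<close> is a morphism.\<close>

definition hom_to_Aut_Gm :: "'a ring \<Rightarrow> 'a alg_group \<Rightarrow>
    ('a extension \<Rightarrow> 'a point \<Rightarrow> 'a point \<Rightarrow> 'a point) \<Rightarrow> bool" where
  "hom_to_Aut_Gm k H \<phi> \<longleftrightarrow>
     (\<forall>e. field_extension k e \<longrightarrow> \<phi> e \<in> hom (grp H e) (Aut_Gm k e)) \<and>
     regular_map k (var_prod k (gvar H) (Gm_var k)) (Gm_var k)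
       (\<lambda>e R. \<phi> e (fst_point (gvar H) (Gm_var k) R) (snd_point (gvar H) (Gm_var k) R))"

definition semidirect_product :: "'a ring \<Rightarrow> 'a alg_group \<Rightarrow> 'a alg_group \<Rightarrow>
    ('a extension \<Rightarrow> 'a point \<Rightarrow> 'a point \<Rightarrow> 'a point) \<Rightarrow> 'a alg_group" where
  "semidirect_product k N H \<phi> = (let
       S = gvar N; T = gvar H; p1 = fst_point S T; p2 = snd_point S T
     in \<lparr> gvar = var_prod k S T,
          grp = (\<lambda>e.
            \<lparr> carrier = var_points k (var_prod k S T) e,
              monoid.mult = (\<lambda>R R'. pair_point S T
                (p1 R \<otimes>\<^bsub>grp N e\<^esub> \<phi> e (p2 R) (p1 R')) (p2 R \<otimes>\<^bsub>grp H e\<^esub> p2 R')),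
              one = pair_point S T \<one>\<^bsub>grp N e\<^esub> \<one>\<^bsub>grp H e\<^esub> \<rparr>) \<rparr>)"

end

theory Submission
  imports Defs
begin

text \<open>Since \<open>\<G>\<close> is commutative, so is the group of points of \<open>\<bbbG>\<^sub>m \<rtimes> \<E>\<close> over every extension of
  \<open>k\<close>. Comparing the two products of \<open>(g, 0)\<close> and \<open>(1, P)\<close> gives \<open>\<phi>(P)(g) = g\<close>, so the semidirect
  product is direct and a point \<open>(g, P)\<close> is divisible by \<open>q\<close> if and only if \<open>g\<close> and \<open>P\<close> are. As
  morphisms over \<open>k\<close> commute with base change to the completions, local-global divisibility passes
  through the isomorphism; a point \<open>g\<close> or \<open>P\<close> of one factor is tested through \<open>(g, 0)\<close> or \<open>(1, P)\<close>.\<close>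

section \<open>Completions are fields\<close>

text \<open>Two obstacles shape the proof. Closure and the group laws are hard to read off the chord
  and tangent formulas. They are imported from \<open>G\<close> instead: its points form a
  commutative group, and the isomorphism is a multiplicative bijection onto the points of the
  semidirect product. So the laws hold for the product as a whole, and closure of the addition on
  the curve is read off from the second components. Only the neutral element of the curve is checked
  on the formulas. The other obstacle is that the hypotheses speak of field extensions of
  \<open>k\<close>, while local divisibility takes place in rings of Cauchy sequences modulo null
  sequences, formed for all absolute values of a class at once. These have to be recognised as
  fields before any hypothesis applies to them. Base change is compatible with points and morphisms
  because equations, inequations and local expressions of morphisms are polynomials over
  \<open>k\<close>, and an embedding of fields is an injective ring homomorphism: zero values stay
  zero and nonzero values stay nonzero.\<close>

locale valued_field = field R for R :: "'a ring" (structure) +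
  fixes v :: "'a \<Rightarrow> real"
  assumes absolute_value: "absolute_value R v"
begin

lemma v_nonneg: "x \<in> carrier R \<Longrightarrow> 0 \<le> v x"
  and v_eq_0_iff: "x \<in> carrier R \<Longrightarrow> v x = 0 \<longleftrightarrow> x = \<zero>"
  and v_mult: "x \<in> carrier R \<Longrightarrow> y \<in> carrier R \<Longrightarrow> v (x \<otimes> y) = v x * v y"
  and v_add: "x \<in> carrier R \<Longrightarrow> y \<in> carrier R \<Longrightarrow> v (x \<oplus> y) \<le> v x + v y"
  using absolute_value unfolding absolute_value_def by auto

lemma v_zero [simp]: "v \<zero> = 0"
  using v_eq_0_iff by blast

lemma v_one [simp]: "v \<one> = 1"
  using v_mult[of \<one> \<one>] v_eq_0_iff[of \<one>] by simp

lemma v_uminus [simp]: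
  assumes "x \<in> carrier R"
  shows "v (\<ominus> x) = v x"
proof -
  have "v (\<ominus> \<one>) * v (\<ominus> \<one>) = v (\<ominus> \<one> \<otimes> \<ominus> \<one>)"
    by (simp add: v_mult)
  also have "\<ominus> \<one> \<otimes> \<ominus> \<one> = \<one>"
    by algebra
  finally have "v (\<ominus> \<one>) * v (\<ominus> \<one>) = 1"
    by simp
  with v_nonneg[of "\<ominus> \<one>"] have "v (\<ominus> \<one>) = 1"
    by (metis a_inv_closed one_closed abs_of_nonneg real_sqrt_abs2 real_sqrt_one)
  moreover have "\<ominus> x = \<ominus> \<one> \<otimes> x"
    using assms by algebra
  ultimately show ?thesis
    using assms by (simp add: v_mult)
qed

lemma v_le_add_minus:
  assumes "x \<in> carrier R" "y \<in> carrier R"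
  shows "v x \<le> v y + v (x \<ominus> y)"
proof -
  have "x = y \<oplus> (x \<ominus> y)"
    using assms by algebra
  then show ?thesis
    using assms v_add[of y "x \<ominus> y"] by simp
qed

lemma v_inv:
  assumes "x \<in> carrier R" "x \<noteq> \<zero>"
  shows "v (inv x) = 1 / v x"
proof -
  have "x \<in> Units R"
    using assms field_Units by auto
  then have "v x * v (inv x) = 1"
    using assms by (metis Units_inv_closed Units_r_inv v_mult v_one)
  then show ?thesis
    using assms by (simp add: v_eq_0_iff eq_divide_eq mult.commute)
qed

section \<open>Cauchy sequences for one absolute value: bounds, sums, products and inverses\<close>

definition Cauchy_seq :: "(nat \<Rightarrow> 'a) \<Rightarrow> bool" where
  "Cauchy_seq s \<longleftrightarrow> (\<forall>n. s n \<in> carrier R) \<and>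
     (\<forall>\<epsilon>>0. \<exists>N. \<forall>m\<ge>N. \<forall>n\<ge>N. v (s m \<ominus> s n) < \<epsilon>)"

lemma Cauchy_seq_closed [simp]: "Cauchy_seq s \<Longrightarrow> s n \<in> carrier R"
  by (simp add: Cauchy_seq_def)

lemma Cauchy_seqD:
  assumes "Cauchy_seq s" "\<epsilon> > 0"
  obtains N where "\<And>m n. m \<ge> N \<Longrightarrow> n \<ge> N \<Longrightarrow> v (s m \<ominus> s n) < \<epsilon>"
  using assms unfolding Cauchy_seq_def by metis

lemma Cauchy_seqI:
  assumes "\<And>n. s n \<in> carrier R"
    and "\<And>\<epsilon>. \<epsilon> > 0 \<Longrightarrow> \<exists>N. \<forall>m\<ge>N. \<forall>n\<ge>N. v (s m \<ominus> s n) < \<epsilon>"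
  shows "Cauchy_seq s"
  using assms by (simp add: Cauchy_seq_def)

lemma Cauchy_seq_const: "x \<in> carrier R \<Longrightarrow> Cauchy_seq (\<lambda>n. x)"
  by (simp add: Cauchy_seq_def r_neg minus_eq)

lemma Cauchy_seq_uminus:
  assumes "Cauchy_seq s"
  shows "Cauchy_seq (\<lambda>n. \<ominus> s n)"
proof -
  have "\<ominus> s m \<ominus> \<ominus> s n = s n \<ominus> s m" for m n
    using Cauchy_seq_closed[OF assms, of m] Cauchy_seq_closed[OF assms, of n] by algebra
  then show ?thesis
    using assms by (simp add: Cauchy_seq_def) meson
qed

lemma Cauchy_seq_add:
  assumes "Cauchy_seq s" "Cauchy_seq t"
  shows "Cauchy_seq (\<lambda>n. s n \<oplus> t n)"
proof (rule Cauchy_seqI)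
  fix \<epsilon> :: real assume "\<epsilon> > 0"
  then obtain M N where M: "\<And>m n. m \<ge> M \<Longrightarrow> n \<ge> M \<Longrightarrow> v (s m \<ominus> s n) < \<epsilon> / 2"
    and N: "\<And>m n. m \<ge> N \<Longrightarrow> n \<ge> N \<Longrightarrow> v (t m \<ominus> t n) < \<epsilon> / 2"
    using Cauchy_seqD[OF assms(1), of "\<epsilon> / 2"] Cauchy_seqD[OF assms(2), of "\<epsilon> / 2"] half_gt_zero
    by metis
  have "v ((s m \<oplus> t m) \<ominus> (s n \<oplus> t n)) < \<epsilon>" if "m \<ge> max M N" "n \<ge> max M N" for m n
  proof -
    have "(s m \<oplus> t m) \<ominus> (s n \<oplus> t n) = (s m \<ominus> s n) \<oplus> (t m \<ominus> t n)"
      using assms[THEN Cauchy_seq_closed, of m] assms[THEN Cauchy_seq_closed, of n] by algebra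
    then have "v ((s m \<oplus> t m) \<ominus> (s n \<oplus> t n)) \<le> v (s m \<ominus> s n) + v (t m \<ominus> t n)"
      using assms by (simp add: v_add)
    then show ?thesis
      using M[of m n] N[of m n] that by simp
  qed
  then show "\<exists>N. \<forall>m\<ge>N. \<forall>n\<ge>N. v ((s m \<oplus> t m) \<ominus> (s n \<oplus> t n)) < \<epsilon>"
    by blast
qed (use assms in simp)

lemma Cauchy_seq_bounded:
  assumes "Cauchy_seq s"
  obtains B where "B > 0" "\<And>n. v (s n) \<le> B"
proof -
  obtain N where N: "\<And>m n. m \<ge> N \<Longrightarrow> n \<ge> N \<Longrightarrow> v (s m \<ominus> s n) < 1"
    using Cauchy_seqD[OF assms, of 1] by auto
  \<comment> \<open>The sum dominates each term up to \<open>N\<close>, among them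
    \<open>s N\<close>; a later term differs from \<open>s N\<close> by less than 1, whence the
    added 1.\<close>
  define B where "B = (\<Sum>i\<le>N. v (s i)) + 1"
  have *: "v (s n) \<le> (\<Sum>i\<le>N. v (s i))" if "n \<le> N" for n
    using that assms by (intro member_le_sum) (auto simp: v_nonneg)
  have "v (s n) \<le> B" for n
  proof (cases "n \<le> N")
    case False
    then show ?thesis
      using v_le_add_minus[of "s n" "s N"] N[of n N] *[of N] assms by (simp add: B_def)
  qed (use * in \<open>force simp: B_def\<close>)
  moreover have "B > 0"
    using *[of 0] v_nonneg[of "s 0"] assms by (simp add: B_def)
  ultimately show ?thesis
    using that by blast
qed

lemma Cauchy_seq_mult:
  assumes "Cauchy_seq s" "Cauchy_seq t"
  shows "Cauchy_seq (\<lambda>n. s n \<otimes> t n)"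
proof (rule Cauchy_seqI)
  fix \<epsilon> :: real assume "\<epsilon> > 0"
  obtain B C where B: "B > 0" "\<And>n. v (s n) \<le> B" and C: "C > 0" "\<And>n. v (t n) \<le> C"
    using Cauchy_seq_bounded assms by metis
  \<comment> \<open>The difference of two products is split below into \<open>s m\<close> times a
    difference plus a difference times \<open>t n\<close>. Dividing by the bound of the other factor
    makes each summand smaller than \<open>\<epsilon> / 2\<close>.\<close>
  obtain M where M: "\<And>m n. m \<ge> M \<Longrightarrow> n \<ge> M \<Longrightarrow> v (s m \<ominus> s n) < \<epsilon> / (2 * C)"
    using Cauchy_seqD[OF assms(1), of "\<epsilon> / (2 * C)"] \<open>\<epsilon> > 0\<close> C(1) by auto
  obtain N where N: "\<And>m n. m \<ge> N \<Longrightarrow> n \<ge> N \<Longrightarrow> v (t m \<ominus> t n) < \<epsilon> / (2 * B)"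
    using Cauchy_seqD[OF assms(2), of "\<epsilon> / (2 * B)"] \<open>\<epsilon> > 0\<close> B(1) by auto
  have "v ((s m \<otimes> t m) \<ominus> (s n \<otimes> t n)) < \<epsilon>" if "m \<ge> max M N" "n \<ge> max M N" for m n
  proof -
    have "(s m \<otimes> t m) \<ominus> (s n \<otimes> t n) = s m \<otimes> (t m \<ominus> t n) \<oplus> (s m \<ominus> s n) \<otimes> t n"
      using assms[THEN Cauchy_seq_closed, of m] assms[THEN Cauchy_seq_closed, of n] by algebra
    then have "v ((s m \<otimes> t m) \<ominus> (s n \<otimes> t n))
        \<le> v (s m \<otimes> (t m \<ominus> t n)) + v ((s m \<ominus> s n) \<otimes> t n)"
      using assms by (simp add: v_add)
    also have "\<dots> = v (s m) * v (t m \<ominus> t n) + v (s m \<ominus> s n) * v (t n)"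
      using assms by (simp add: v_mult)
    also have "\<dots> \<le> B * v (t m \<ominus> t n) + v (s m \<ominus> s n) * C"
      using assms B C by (intro add_mono mult_right_mono mult_left_mono) (auto simp: v_nonneg)
    also have "\<dots> < B * (\<epsilon> / (2 * B)) + \<epsilon> / (2 * C) * C"
      using M[of m n] N[of m n] that B(1) C(1)
      by (intro add_strict_mono mult_strict_right_mono mult_strict_left_mono) auto
    also have "\<dots> = \<epsilon>"
      using B(1) C(1) by (simp add: field_simps)
    finally show ?thesis .
  qed
  then show "\<exists>N. \<forall>m\<ge>N. \<forall>n\<ge>N. v ((s m \<otimes> t m) \<ominus> (s n \<otimes> t n)) < \<epsilon>"
    by blast
qed (use assms in simp)

text \<open>If the values do not tend to 0, some \<epsilon> is reached arbitrarily far out. The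
  Cauchy condition keeps all late terms within \<epsilon> / 2 of such a term, so their values are at
  least \<epsilon> / 2. This is what makes a sequence that is not null invertible modulo null
  sequences.\<close>

lemma Cauchy_seq_bounded_below:
  assumes "Cauchy_seq s" "\<not> (\<lambda>n. v (s n)) \<longlonglongrightarrow> 0"
  obtains c N where "c > 0" "\<And>n. n \<ge> N \<Longrightarrow> c \<le> v (s n)"
proof -
  obtain \<epsilon> where \<epsilon>: "\<epsilon> > 0" "\<And>N. \<exists>n\<ge>N. \<epsilon> \<le> v (s n)"
    using assms(2) v_nonneg Cauchy_seq_closed[OF assms(1)]
    unfolding LIMSEQ_iff by (auto simp: not_less)
  obtain N where N: "\<And>m n. m \<ge> N \<Longrightarrow> n \<ge> N \<Longrightarrow> v (s m \<ominus> s n) < \<epsilon> / 2"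
    using Cauchy_seqD[OF assms(1), of "\<epsilon> / 2"] \<epsilon>(1) by auto
  obtain n where n: "n \<ge> N" "\<epsilon> \<le> v (s n)"
    using \<epsilon>(2) by blast
  have "\<epsilon> / 2 \<le> v (s m)" if "m \<ge> N" for m
    using v_le_add_minus[of "s n" "s m"] N[of n m] n that assms(1) by simp
  then show ?thesis
    using that[of "\<epsilon> / 2" N] \<epsilon>(1) by simp
qed

text \<open>Terms before \<open>N\<close> may be zero, so they get a default value, which the Cauchy
  condition does not see. From \<open>N\<close> on, 1/a - 1/b = (b - a)/(ab), where the value of the
  denominator is at least \<open>c\<^sup>2\<close>; this explains the tolerance
  \<open>\<epsilon> * c\<^sup>2\<close>.\<close>

lemma Cauchy_seq_inverse:
  assumes "Cauchy_seq s" "c > 0" "\<And>n. n \<ge> N \<Longrightarrow> c \<le> v (s n)"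
  shows "Cauchy_seq (\<lambda>n. if n \<ge> N then inv (s n) else \<zero>)" (is "Cauchy_seq ?t")
proof (rule Cauchy_seqI)
  have ne: "s n \<noteq> \<zero>" if "n \<ge> N" for n
    using assms(2) assms(3)[OF that] by auto
  then have unit: "s n \<in> Units R" if "n \<ge> N" for n
    using assms(1) field_Units that by auto
  then show "?t n \<in> carrier R" for n
    by simp
  fix \<epsilon> :: real assume "\<epsilon> > 0"
  then obtain M where M: "\<And>m n. m \<ge> M \<Longrightarrow> n \<ge> M \<Longrightarrow> v (s m \<ominus> s n) < \<epsilon> * c\<^sup>2"
    using Cauchy_seqD[OF assms(1), of "\<epsilon> * c\<^sup>2"] assms(2) by auto
  have "v (?t m \<ominus> ?t n) < \<epsilon>" if mn: "m \<ge> max M N" "n \<ge> max M N" for m n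
  proof -
    let ?a = "s m" and ?b = "s n"
    have U: "?a \<in> Units R" "?b \<in> Units R" and nz: "?a \<noteq> \<zero>" "?b \<noteq> \<zero>"
      using unit ne mn by auto
    have "inv ?a \<ominus> inv ?b = inv ?a \<otimes> (?b \<otimes> inv ?b) \<ominus> (?a \<otimes> inv ?a) \<otimes> inv ?b"
      using U by simp
    also have "\<dots> = inv ?a \<otimes> inv ?b \<otimes> (?b \<ominus> ?a)"
      using Units_inv_closed[OF U(1)] Units_inv_closed[OF U(2)] Units_closed[OF U(1)] Units_closed[OF U(2)]
      by algebra
    finally have "v (inv ?a \<ominus> inv ?b) = v (?b \<ominus> ?a) / (v ?a * v ?b)"
      using U nz Units_closed by (simp add: v_mult v_inv)
    also have "\<dots> \<le> v (?b \<ominus> ?a) / (c * c)"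
    proof (intro divide_left_mono mult_mono mult_pos_pos)
      show "c \<le> v ?a" "c \<le> v ?b"
        using assms(3) mn by auto
      then show "0 < v ?a" "0 < v ?b"
        using assms(2) by linarith+
    qed (use assms v_nonneg in auto)
    also have "\<dots> < \<epsilon>"
      using M[of n m] mn assms(2) by (simp add: divide_simps power2_eq_square)
    finally show ?thesis
      using mn by simp
  qed
  then show "\<exists>N. \<forall>m\<ge>N. \<forall>n\<ge>N. v (?t m \<ominus> ?t n) < \<epsilon>"
    by blast
qed

section \<open>The ring of Cauchy sequences and the maximal ideal of null sequences\<close>

abbreviation "CR \<equiv> cauchy_ring R {v}"
abbreviation "NS \<equiv> null_seqs R {v}"

lemma carrier_CR: "carrier CR = {s. Cauchy_seq s}"
  by (simp add: cauchy_ring_def Cauchy_seq_def)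

lemma CR_simps [simp]:
  "s \<otimes>\<^bsub>CR\<^esub> t = (\<lambda>n. s n \<otimes> t n)" "s \<oplus>\<^bsub>CR\<^esub> t = (\<lambda>n. s n \<oplus> t n)"
  "\<one>\<^bsub>CR\<^esub> = (\<lambda>n. \<one>)" "\<zero>\<^bsub>CR\<^esub> = (\<lambda>n. \<zero>)"
  by (simp_all add: cauchy_ring_def)

lemma cring_CR: "cring CR"
proof (rule cringI)
  show "abelian_group CR"
  proof (rule abelian_groupI)
    fix s assume s: "s \<in> carrier CR"
    then have "(\<lambda>n. \<ominus> s n) \<in> carrier CR"
      by (simp add: carrier_CR Cauchy_seq_uminus)
    moreover have "(\<lambda>n. \<ominus> s n) \<oplus>\<^bsub>CR\<^esub> s = \<zero>\<^bsub>CR\<^esub>"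
      using s by (simp add: carrier_CR l_neg)
    ultimately show "\<exists>t\<in>carrier CR. t \<oplus>\<^bsub>CR\<^esub> s = \<zero>\<^bsub>CR\<^esub>"
      by blast
  qed (simp_all add: carrier_CR Cauchy_seq_add Cauchy_seq_const a_ac)
  show "comm_monoid CR"
    by (rule comm_monoidI) (simp_all add: carrier_CR Cauchy_seq_mult Cauchy_seq_const m_ac)
qed (simp add: carrier_CR l_distr)

lemma NS_iff: "s \<in> NS \<longleftrightarrow> Cauchy_seq s \<and> (\<lambda>n. v (s n)) \<longlonglongrightarrow> 0"
  by (simp add: null_seqs_def carrier_CR)

text \<open>A Cauchy sequence is bounded, and bounded times null is null.\<close>

lemma NS_mult:
  assumes "s \<in> NS" "Cauchy_seq t"
  shows "(\<lambda>n. t n \<otimes> s n) \<in> NS"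
proof -
  obtain B where B: "\<And>n. v (t n) \<le> B"
    using Cauchy_seq_bounded[OF assms(2)] by blast
  have lim: "(\<lambda>n. B * v (s n)) \<longlonglongrightarrow> 0"
    using assms by (intro tendsto_mult_right_zero) (simp add: NS_iff)
  have "(\<lambda>n. v (t n \<otimes> s n)) \<longlonglongrightarrow> 0"
    by (rule tendsto_sandwich[OF _ _ tendsto_const lim])
      (use assms B in \<open>simp_all add: NS_iff v_mult v_nonneg mult_right_mono\<close>)
  then show ?thesis
    using assms by (simp add: NS_iff Cauchy_seq_mult)
qed

lemma ideal_NS: "ideal NS CR"
proof (rule idealI)
  interpret CR: cring CR by (rule cring_CR)
  show "ring CR"
    by (rule CR.ring_axioms)
  show "subgroup NS (add_monoid CR)"
  proof (rule CR.add.subgroupI)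
    show "NS \<subseteq> carrier CR"
      by (auto simp: NS_iff carrier_CR)
    show "NS \<noteq> {}"
    proof -
      have "(\<lambda>n. \<zero>) \<in> NS"
        using Cauchy_seq_const[of \<zero>] by (simp add: NS_iff)
      then show ?thesis
        by blast
    qed
    fix s t assume st: "s \<in> NS" "t \<in> NS"
    have "\<ominus>\<^bsub>CR\<^esub> s = (\<lambda>n. \<ominus> s n)"
      using st by (intro CR.minus_equality) (auto simp: NS_iff carrier_CR Cauchy_seq_uminus l_neg)
    then show "\<ominus>\<^bsub>CR\<^esub> s \<in> NS"
      using st by (simp add: NS_iff Cauchy_seq_uminus)
    have lim: "(\<lambda>n. v (s n) + v (t n)) \<longlonglongrightarrow> 0"
      using st by (intro tendsto_add_zero) (simp_all add: NS_iff)
    have "(\<lambda>n. v (s n \<oplus> t n)) \<longlonglongrightarrow> 0"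
      by (rule tendsto_sandwich[OF _ _ tendsto_const lim])
        (use st in \<open>simp_all add: NS_iff v_nonneg v_add\<close>)
    then show "s \<oplus>\<^bsub>CR\<^esub> t \<in> NS"
      using st by (simp add: NS_iff Cauchy_seq_add)
  qed
  show "t \<otimes>\<^bsub>CR\<^esub> s \<in> NS" "s \<otimes>\<^bsub>CR\<^esub> t \<in> NS" if "s \<in> NS" "t \<in> carrier CR" for s t
  proof -
    show "t \<otimes>\<^bsub>CR\<^esub> s \<in> NS"
      using NS_mult that by (simp add: carrier_CR)
    then show "s \<otimes>\<^bsub>CR\<^esub> t \<in> NS"
      using that CR.m_comm[of s t] by (simp add: carrier_CR NS_iff)
  qed
qed

text \<open>Let an ideal \<open>J\<close> contain all null sequences and a sequence \<open>s\<close>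
  that is not null. Then \<open>s\<close> has an inverse \<open>t\<close> from some index on, so
  \<open>u = 1 - ts\<close> vanishes from there on, is null and lies in \<open>J\<close>. Hence 1 =
  \<open>u + ts\<close> lies in \<open>J\<close>.\<close>

lemma maximalideal_NS: "maximalideal NS CR"
proof (rule maximalidealI)
  interpret CR: cring CR by (rule cring_CR)
  show "ideal NS CR"
    by (rule ideal_NS)
  show "carrier CR \<noteq> NS"
  proof
    assume "carrier CR = NS"
    then have "\<one>\<^bsub>CR\<^esub> \<in> NS"
      using CR.one_closed by simp
    then show False
      by (simp add: NS_iff LIMSEQ_const_iff)
  qed
  fix J assume J: "ideal J CR" "NS \<subseteq> J" "J \<subseteq> carrier CR"
  interpret J: ideal J CR by (rule J(1))
  show "J = NS \<or> J = carrier CR"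
  proof (rule disjCI)
    assume "J \<noteq> carrier CR"
    show "J = NS"
    proof (rule ccontr)
      assume "J \<noteq> NS"
      then obtain s where s: "s \<in> J" "s \<notin> NS"
        using J by blast
      then have Cs: "Cauchy_seq s"
        using J by (auto simp: carrier_CR)
      then obtain c N where cN: "c > 0" "\<And>n. n \<ge> N \<Longrightarrow> c \<le> v (s n)"
        using Cauchy_seq_bounded_below s by (auto simp: NS_iff)
      define t where "t = (\<lambda>n. if n \<ge> N then inv (s n) else \<zero>)"
      have Ct: "Cauchy_seq t"
        unfolding t_def by (rule Cauchy_seq_inverse[OF Cs cN])
      define u where "u = (\<lambda>n. \<one> \<oplus> \<ominus> (t n \<otimes> s n))"
      have Cu: "Cauchy_seq u"
        unfolding u_def
        by (intro Cauchy_seq_add Cauchy_seq_const Cauchy_seq_uminus Cauchy_seq_mult Ct Cs) simp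
      have "u n = \<zero>" if "n \<ge> N" for n
      proof -
        have "s n \<noteq> \<zero>"
          using cN(1) cN(2)[OF that] by auto
        then have "s n \<in> Units R"
          using Cs by (simp add: field_Units)
        then have "t n \<otimes> s n = \<one>"
          using that by (simp add: t_def)
        then show ?thesis
          by (simp only: u_def r_neg one_closed)
      qed
      then have "(\<lambda>n. v (u n)) \<longlonglongrightarrow> 0"
        by (intro tendsto_eventually eventually_sequentiallyI[of N]) simp
      then have "u \<in> J"
        using Cu J by (auto simp: NS_iff)
      moreover have "t \<otimes>\<^bsub>CR\<^esub> s \<in> J"
        using s Ct by (intro J.I_l_closed) (simp_all add: carrier_CR)
      ultimately have "u \<oplus>\<^bsub>CR\<^esub> (t \<otimes>\<^bsub>CR\<^esub> s) \<in> J"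
        by (rule J.a_closed)
      moreover have "u \<oplus>\<^bsub>CR\<^esub> (t \<otimes>\<^bsub>CR\<^esub> s) = \<one>\<^bsub>CR\<^esub>"
        using Cs Ct by (simp add: u_def a_assoc l_neg)
      ultimately have "J = carrier CR"
        using J.one_imp_carrier by simp
      with \<open>J \<noteq> carrier CR\<close> show False ..
    qed
  qed
qed

lemma field_extension_completion_singleton:
  "field_extension R (completion_extension R {v})"
proof -
  have "field (completion R {v})"
    unfolding completion_def by (rule maximalideal.quotient_is_field[OF maximalideal_NS cring_CR])
  moreover have "completion_emb R {v} \<in> ring_hom R (completion R {v})"
  proof -
    have "(\<lambda>x n. x) \<in> ring_hom R CR"
      by (rule ring_hom_memI) (simp_all add: carrier_CR Cauchy_seq_const)
    then have "(+>\<^bsub>CR\<^esub>) NS \<circ> (\<lambda>x n. x) \<in> ring_hom R (CR Quot NS)"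
      using ideal.rcos_ring_hom[OF ideal_NS] by (rule ring_hom_trans)
    moreover have "(+>\<^bsub>CR\<^esub>) NS \<circ> (\<lambda>x n. x) = completion_emb R {v}"
      by (rule ext) (simp only: completion_emb_def o_apply)
    ultimately show ?thesis
      by (simp only: completion_def)
  qed
  ultimately show ?thesis
    by (simp only: field_extension_def completion_extension_def fst_conv snd_conv simp_thms)
qed

end

section \<open>Places and the choice of a representative\<close>

lemma places_obtain:
  assumes "V \<in> places k"
  obtains v where "v \<in> V" "nontrivial_absolute_value k v"
    and "\<And>w. w \<in> V \<Longrightarrow> \<exists>s>0. \<forall>x\<in>carrier k. w x = v x powr s"
proof -
  obtain v where v: "nontrivial_absolute_value k v" "V = absolute_value_equiv k `` {v}"
    using assms unfolding places_def by (auto elim: quotientE)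
  \<comment> \<open>The exponent 1 shows that \<open>v\<close> lies in its own class;
    \<open>powr\<close> with this exponent returns the value because an absolute value is
    nonnegative.\<close>
  have "\<forall>x\<in>carrier k. v x = v x powr 1"
    using v(1) by (auto simp: nontrivial_absolute_value_def absolute_value_def)
  then have "v \<in> V"
    using v by (auto simp: absolute_value_equiv_def intro!: exI[of _ "1::real"])
  then show ?thesis
    using that v by (auto simp: absolute_value_equiv_def)
qed

text \<open>Equivalent absolute values have the same Cauchy and null sequences, so that one of them
  suffices to form the completion.\<close>

lemma completion_extension_singleton:
  assumes "field k" "V \<in> places k"
  obtains v where "absolute_value k v" "completion_extension k V = completion_extension k {v}"
proof -
  obtain v where v: "v \<in> V" "nontrivial_absolute_value k v"
    and eq: "\<And>w. w \<in> V \<Longrightarrow> \<exists>s>0. \<forall>x\<in>carrier k. w x = v x powr s"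
    using places_obtain[OF assms(2)] by metis
  interpret valued_field k v
    using assms(1) v(2)
    by (simp add: valued_field_def valued_field_axioms_def nontrivial_absolute_value_def)
  have Cauchy: "\<exists>N. \<forall>m\<ge>N. \<forall>n\<ge>N. w (s m \<ominus>\<^bsub>k\<^esub> s n) < \<epsilon>"
    if s: "Cauchy_seq s" "w \<in> V" "\<epsilon> > 0" for s w and \<epsilon> :: real
  proof -
    obtain r where r: "r > 0" "\<And>x. x \<in> carrier k \<Longrightarrow> w x = v x powr r"
      using eq[OF \<open>w \<in> V\<close>] by auto
    \<comment> \<open>On \<open>k\<close>, \<open>w\<close> is the \<open>r\<close>-th power of
      \<open>v\<close>, so the tolerance \<epsilon> for \<open>w\<close> corresponds to its
      \<open>r\<close>-th root for \<open>v\<close>.\<close>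
    obtain N where N: "\<And>m n. m \<ge> N \<Longrightarrow> n \<ge> N \<Longrightarrow> v (s m \<ominus>\<^bsub>k\<^esub> s n) < \<epsilon> powr (1 / r)"
      using Cauchy_seqD[OF s(1), of "\<epsilon> powr (1 / r)"] \<open>\<epsilon> > 0\<close> by auto
    have "w (s m \<ominus>\<^bsub>k\<^esub> s n) < \<epsilon>" if "m \<ge> N" "n \<ge> N" for m n
    proof -
      have "v (s m \<ominus>\<^bsub>k\<^esub> s n) powr r < (\<epsilon> powr (1 / r)) powr r"
        using N[OF that] r(1) v_nonneg \<open>Cauchy_seq s\<close> by (intro powr_less_mono2) auto
      then show ?thesis
        using r \<open>\<epsilon> > 0\<close> \<open>Cauchy_seq s\<close> by (simp add: powr_powr)
    qed
    then show ?thesis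
      by blast
  qed
  have CR: "cauchy_ring k V = CR"
  proof -
    have "(\<forall>n. s n \<in> carrier k) \<and>
        (\<forall>w\<in>V. \<forall>\<epsilon>>0. \<exists>N. \<forall>m\<ge>N. \<forall>n\<ge>N. w (s m \<ominus>\<^bsub>k\<^esub> s n) < \<epsilon>) \<longleftrightarrow> Cauchy_seq s" for s
    proof (intro iffI conjI allI ballI impI)
      assume "Cauchy_seq s"
      then show "s n \<in> carrier k" for n
        by simp
      fix w \<epsilon> assume "w \<in> V" "(\<epsilon>::real) > 0"
      then show "\<exists>N. \<forall>m\<ge>N. \<forall>n\<ge>N. w (s m \<ominus>\<^bsub>k\<^esub> s n) < \<epsilon>"
        using Cauchy[OF \<open>Cauchy_seq s\<close>] by simp
    next
      assume "(\<forall>n. s n \<in> carrier k) \<and>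
        (\<forall>w\<in>V. \<forall>\<epsilon>>0. \<exists>N. \<forall>m\<ge>N. \<forall>n\<ge>N. w (s m \<ominus>\<^bsub>k\<^esub> s n) < \<epsilon>)"
      then show "Cauchy_seq s"
        using v(1) unfolding Cauchy_seq_def by fast
    qed
    then show ?thesis
      unfolding cauchy_ring_def Cauchy_seq_def by simp
  qed
  have null: "(\<lambda>n. w (s n)) \<longlonglongrightarrow> 0"
    if s: "Cauchy_seq s" and w: "w \<in> V" and lim: "(\<lambda>n. v (s n)) \<longlonglongrightarrow> 0" for s w
  proof -
    obtain r where r: "r > 0" "\<And>x. x \<in> carrier k \<Longrightarrow> w x = v x powr r"
      using eq[OF \<open>w \<in> V\<close>] by auto
    have "(\<lambda>n. v (s n) powr r) \<longlonglongrightarrow> 0 powr r"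
      using r(1) v_nonneg s by (intro tendsto_powr'[OF lim tendsto_const]) (simp add: always_eventually)
    then show ?thesis
      using r(1) by (simp add: r(2) s)
  qed
  have NS: "null_seqs k V = NS"
    using v(1) null by (auto simp: null_seqs_def CR carrier_CR)
  have "completion_extension k V = completion_extension k {v}"
    unfolding completion_extension_def completion_def completion_emb_def CR NS ..
  then show ?thesis
    using that absolute_value by blast
qed

lemma field_extension_completion:
  assumes "field k" "V \<in> places k"
  shows "field_extension k (completion_extension k V)"
proof -
  obtain v where v: "absolute_value k v" "completion_extension k V = completion_extension k {v}"
    using completion_extension_singleton[OF assms] .
  interpret valued_field k v
    using assms(1) v(1) by (simp add: valued_field_def valued_field_axioms_def)
  show ?thesis
    using field_extension_completion_singleton v(2) by simp
qed

text \<open>Sending an element to the singleton of its constant sequence is injective, so the copy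
  of \<open>k\<close> in the common type inherits the field structure and the copying map is an
  embedding.\<close>

lemma field_extension_base:
  assumes "field k"
  shows "field_extension k (base_extension k)"
proof -
  interpret field k by (rule assms)
  have inj: "inj_on (\<lambda>x. {\<lambda>n::nat. x}) (carrier k)"
    by (auto simp: inj_on_def fun_eq_iff)
  show ?thesis
    using inj_imp_image_ring_is_field[OF inj] inj_imp_image_ring_iso[OF inj]
    by (simp add: field_extension_def base_extension_def ring_iso_def)
qed

section \<open>Points of products of projective spaces\<close>

text \<open>\<open>glue\<close>, \<open>left_part\<close> and \<open>right_part\<close> do to single
  coordinate vectors what \<open>pair_point\<close>, \<open>fst_point\<close> and
  \<open>snd_point\<close> do to classes. The factors of the second variety carry indices raised by
  \<open>length ds\<close>. Outside the index set the value is \<open>undefined\<close>, as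
  \<open>hom_coords\<close> demands.\<close>

definition glue :: "nat list \<Rightarrow> nat list \<Rightarrow> (nat \<times> nat \<Rightarrow> 'u) \<Rightarrow> (nat \<times> nat \<Rightarrow> 'u) \<Rightarrow> nat \<times> nat \<Rightarrow> 'u" where
  "glue ds es x y = (\<lambda>(i, j)\<in>coord_index (ds @ es).
     if i < length ds then x (i, j) else y (i - length ds, j))"

definition left_part :: "nat list \<Rightarrow> (nat \<times> nat \<Rightarrow> 'u) \<Rightarrow> nat \<times> nat \<Rightarrow> 'u" where
  "left_part ds z = (\<lambda>u\<in>coord_index ds. z u)"

definition right_part :: "nat list \<Rightarrow> nat list \<Rightarrow> (nat \<times> nat \<Rightarrow> 'u) \<Rightarrow> nat \<times> nat \<Rightarrow> 'u" where
  "right_part ds es z = (\<lambda>(i, j)\<in>coord_index es. z (i + length ds, j))"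

lemma coord_index_iff: "(i, j) \<in> coord_index ds \<longleftrightarrow> i < length ds \<and> j \<le> ds ! i"
  by (auto simp: coord_index_def)

lemma coord_index_append_left: "i < length ds \<Longrightarrow>
    (i, j) \<in> coord_index (ds @ es) \<longleftrightarrow> (i, j) \<in> coord_index ds"
  by (simp add: coord_index_iff nth_append)

lemma coord_index_append_right:
  "(i + length ds, j) \<in> coord_index (ds @ es) \<longleftrightarrow> (i, j) \<in> coord_index es"
  "\<not> i < length ds \<Longrightarrow> (i, j) \<in> coord_index (ds @ es) \<longleftrightarrow> (i - length ds, j) \<in> coord_index es"
  by (auto simp: coord_index_iff nth_append)

lemma coord_index_subset_append: "coord_index ds \<subseteq> coord_index (ds @ es)"
  by (auto simp: coord_index_iff nth_append)

lemma hom_coords_closed: "x \<in> hom_coords ds L \<Longrightarrow> u \<in> coord_index ds \<Longrightarrow> x u \<in> carrier L"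
  by (auto simp: hom_coords_def)

lemma hom_coords_extensional: "x \<in> hom_coords ds L \<Longrightarrow> u \<notin> coord_index ds \<Longrightarrow> x u = undefined"
  by (cases u) (auto simp: hom_coords_def PiE_def extensional_def)

lemma hom_coords_eqI:
  assumes "x \<in> hom_coords ds L" "y \<in> hom_coords ds L"
    and "\<And>i j. (i, j) \<in> coord_index ds \<Longrightarrow> x (i, j) = y (i, j)"
  shows "x = y"
proof
  fix u show "x u = y u"
    using assms(3) hom_coords_extensional[OF assms(1), of u] hom_coords_extensional[OF assms(2), of u]
    by (cases u; cases "u \<in> coord_index ds") simp_all
qed

lemma hom_coordsI:
  assumes "\<And>i j. (i, j) \<in> coord_index ds \<Longrightarrow> x (i, j) \<in> carrier L"
    and "\<And>u. u \<notin> coord_index ds \<Longrightarrow> x u = undefined"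
    and "\<And>i. i < length ds \<Longrightarrow> \<exists>j\<le>ds ! i. x (i, j) \<noteq> \<zero>\<^bsub>L\<^esub>"
  shows "x \<in> hom_coords ds L"
  using assms by (auto simp: hom_coords_def PiE_def extensional_def)

lemma hom_coords_nonzero:
  assumes "x \<in> hom_coords ds L" "i < length ds"
  obtains j where "j \<le> ds ! i" "x (i, j) \<noteq> \<zero>\<^bsub>L\<^esub>"
  using assms by (auto simp: hom_coords_def)

lemma left_part_mem:
  assumes "z \<in> hom_coords (ds @ es) L"
  shows "left_part ds z \<in> hom_coords ds L"
proof (rule hom_coordsI)
  show "left_part ds z (i, j) \<in> carrier L" if "(i, j) \<in> coord_index ds" for i j
    using that coord_index_subset_append[of ds es] hom_coords_closed[OF assms, of "(i, j)"]
    by (auto simp: left_part_def)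
  fix i assume "i < length ds"
  then show "\<exists>j\<le>ds ! i. left_part ds z (i, j) \<noteq> \<zero>\<^bsub>L\<^esub>"
    using hom_coords_nonzero[OF assms, of i]
    by (auto simp: left_part_def coord_index_iff nth_append)
qed (simp add: left_part_def)

lemma right_part_mem:
  assumes "z \<in> hom_coords (ds @ es) L"
  shows "right_part ds es z \<in> hom_coords es L"
proof (rule hom_coordsI)
  show "right_part ds es z (i, j) \<in> carrier L" if "(i, j) \<in> coord_index es" for i j
    using that hom_coords_closed[OF assms, of "(i + length ds, j)"]
    by (simp add: right_part_def coord_index_append_right)
  fix i assume "i < length es"
  then show "\<exists>j\<le>es ! i. right_part ds es z (i, j) \<noteq> \<zero>\<^bsub>L\<^esub>"
    using hom_coords_nonzero[OF assms, of "i + length ds"]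
    by (auto simp: right_part_def coord_index_iff nth_append)
qed (auto simp: right_part_def)

lemma glue_mem:
  assumes "x \<in> hom_coords ds L" "y \<in> hom_coords es L"
  shows "glue ds es x y \<in> hom_coords (ds @ es) L"
proof (rule hom_coordsI)
  show "glue ds es x y (i, j) \<in> carrier L" if "(i, j) \<in> coord_index (ds @ es)" for i j
    using that hom_coords_closed[OF assms(1), of "(i, j)"]
      hom_coords_closed[OF assms(2), of "(i - length ds, j)"]
    by (auto simp: glue_def coord_index_append_left coord_index_append_right)
  fix i assume i: "i < length (ds @ es)"
  show "\<exists>j\<le>(ds @ es) ! i. glue ds es x y (i, j) \<noteq> \<zero>\<^bsub>L\<^esub>"
  proof (cases "i < length ds")
    case True
    then obtain j where "j \<le> ds ! i" "x (i, j) \<noteq> \<zero>\<^bsub>L\<^esub>"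
      using hom_coords_nonzero[OF assms(1)] by blast
    then show ?thesis
      using True by (intro exI[of _ j]) (simp add: glue_def coord_index_iff nth_append)
  next
    case False
    then obtain j where "j \<le> es ! (i - length ds)" "y (i - length ds, j) \<noteq> \<zero>\<^bsub>L\<^esub>"
      using hom_coords_nonzero[OF assms(2), of "i - length ds"] False i
      by (metis add.commute length_append less_diff_conv2 not_less)
    then show ?thesis
      using False i by (intro exI[of _ j]) (auto simp: glue_def coord_index_iff nth_append)
  qed
qed (auto simp: glue_def)

lemma left_part_glue:
  assumes "x \<in> hom_coords ds L"
  shows "left_part ds (glue ds es x y) = x"
proof
  fix u show "left_part ds (glue ds es x y) u = x u"
    using hom_coords_extensional[OF assms, of u]
    by (cases u) (auto simp: left_part_def glue_def coord_index_iff nth_append)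
qed

lemma right_part_glue:
  assumes "y \<in> hom_coords es L"
  shows "right_part ds es (glue ds es x y) = y"
proof
  fix u show "right_part ds es (glue ds es x y) u = y u"
    using hom_coords_extensional[OF assms, of u]
    by (cases u) (auto simp: right_part_def glue_def coord_index_append_right)
qed

lemma glue_parts:
  assumes "z \<in> hom_coords (ds @ es) L"
  shows "glue ds es (left_part ds z) (right_part ds es z) = z"
proof (rule hom_coords_eqI)
  show "glue ds es (left_part ds z) (right_part ds es z) \<in> hom_coords (ds @ es) L"
    by (intro glue_mem left_part_mem[OF assms] right_part_mem[OF assms])
  fix i j assume ij: "(i, j) \<in> coord_index (ds @ es)"
  show "glue ds es (left_part ds z) (right_part ds es z) (i, j) = z (i, j)"
  proof (cases "i < length ds")
    case True
    then show ?thesis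
      using ij by (simp add: glue_def left_part_def coord_index_append_left)
  next
    case False
    then show ?thesis
      using ij by (simp add: glue_def right_part_def coord_index_append_right)
  qed
qed (rule assms)

section \<open>Projective points as classes of proportional coordinate vectors\<close>

lemma proj_pointE:
  assumes "y \<in> proj_point ds L x"
  obtains c where "y \<in> hom_coords ds L"
    and "\<And>i. i < length ds \<Longrightarrow> c i \<in> carrier L - {\<zero>\<^bsub>L\<^esub>}"
    and "\<And>i j. (i, j) \<in> coord_index ds \<Longrightarrow> y (i, j) = c i \<otimes>\<^bsub>L\<^esub> x (i, j)"
proof -
  obtain c where "y \<in> hom_coords ds L" "\<forall>i<length ds. c i \<in> carrier L - {\<zero>\<^bsub>L\<^esub>}"
    "\<forall>(i, j)\<in>coord_index ds. y (i, j) = c i \<otimes>\<^bsub>L\<^esub> x (i, j)"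
    using assms unfolding proj_point_def by blast
  then show ?thesis
    by (intro that[of c]) blast+
qed

lemma proj_pointI:
  assumes "y \<in> hom_coords ds L"
    and "\<And>i. i < length ds \<Longrightarrow> c i \<in> carrier L - {\<zero>\<^bsub>L\<^esub>}"
    and "\<And>i j. (i, j) \<in> coord_index ds \<Longrightarrow> y (i, j) = c i \<otimes>\<^bsub>L\<^esub> x (i, j)"
  shows "y \<in> proj_point ds L x"
  using assms unfolding proj_point_def by blast

lemma proj_point_subset: "proj_point ds L x \<subseteq> hom_coords ds L"
  by (auto simp: proj_point_def)

locale plain_field = field R for R :: "'u ring" (structure)
begin

lemma mult_nonzero: "a \<in> carrier R - {\<zero>} \<Longrightarrow> b \<in> carrier R - {\<zero>} \<Longrightarrow> a \<otimes> b \<in> carrier R - {\<zero>}"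
  using integral by auto

lemma inv_nonzero:
  assumes "a \<in> carrier R - {\<zero>}"
  shows "inv a \<in> carrier R - {\<zero>}" "inv a \<otimes> a = \<one>" "a \<otimes> inv a = \<one>"
proof -
  have "a \<in> Units R"
    using assms by (simp add: field_Units)
  then show "inv a \<in> carrier R - {\<zero>}" "inv a \<otimes> a = \<one>" "a \<otimes> inv a = \<one>"
    using field_Units by auto
qed

lemma self_mem_proj_point:
  assumes "x \<in> hom_coords ds R"
  shows "x \<in> proj_point ds R x"
  by (rule proj_pointI[of _ _ _ "\<lambda>_. \<one>"]) (use assms in \<open>auto simp: hom_coords_closed\<close>)

lemma scale_mem:
  assumes "x \<in> hom_coords ds R" "\<And>i. i < length ds \<Longrightarrow> c i \<in> carrier R - {\<zero>}"
  shows "(\<lambda>(i, j)\<in>coord_index ds. c i \<otimes> x (i, j)) \<in> hom_coords ds R"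
proof (rule hom_coordsI)
  fix i assume i: "i < length ds"
  then obtain j where j: "j \<le> ds ! i" "x (i, j) \<noteq> \<zero>"
    using hom_coords_nonzero[OF assms(1)] by blast
  then show "\<exists>j\<le>ds ! i. (\<lambda>(i, j)\<in>coord_index ds. c i \<otimes> x (i, j)) (i, j) \<noteq> \<zero>"
    using i assms(2)[OF i] hom_coords_closed[OF assms(1), of "(i, j)"]
    by (intro exI[of _ j]) (auto simp: coord_index_iff integral_iff)
qed (use assms in \<open>auto simp: coord_index_iff hom_coords_closed\<close>)

text \<open>The scalars attached to the factors are units, so proportionality can be inverted and
  composed factor by factor; any representative yields the same class.\<close>

lemma proj_point_eq:
  assumes "y \<in> proj_point ds R x" "x \<in> hom_coords ds R"
  shows "proj_point ds R y = proj_point ds R x"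
proof -
  obtain c where c: "\<And>i. i < length ds \<Longrightarrow> c i \<in> carrier R - {\<zero>}"
    and y: "\<And>i j. (i, j) \<in> coord_index ds \<Longrightarrow> y (i, j) = c i \<otimes> x (i, j)"
    using proj_pointE[OF assms(1)] by metis
  have x: "x (i, j) = inv (c i) \<otimes> y (i, j)" if "(i, j) \<in> coord_index ds" for i j
    using that y[OF that] c[of i] inv_nonzero[OF c[of i]] hom_coords_closed[OF assms(2) that]
    by (simp add: coord_index_iff m_assoc[symmetric])
  show ?thesis
  proof (intro equalityI subsetI)
    fix z assume zp: "z \<in> proj_point ds R y"
    then obtain d where d: "\<And>i. i < length ds \<Longrightarrow> d i \<in> carrier R - {\<zero>}"
      and z: "z \<in> hom_coords ds R" "\<And>i j. (i, j) \<in> coord_index ds \<Longrightarrow> z (i, j) = d i \<otimes> y (i, j)"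
      using proj_pointE[OF zp] by metis
    have "z (i, j) = (d i \<otimes> c i) \<otimes> x (i, j)" if "(i, j) \<in> coord_index ds" for i j
      using that z(2)[OF that] y[OF that] c[of i] d[of i] hom_coords_closed[OF assms(2) that]
      by (simp add: coord_index_iff m_assoc)
    then show "z \<in> proj_point ds R x"
      using z(1) c d mult_nonzero by (intro proj_pointI[of _ _ _ "\<lambda>i. d i \<otimes> c i"]) blast+
  next
    fix z assume zp: "z \<in> proj_point ds R x"
    then obtain d where d: "\<And>i. i < length ds \<Longrightarrow> d i \<in> carrier R - {\<zero>}"
      and z: "z \<in> hom_coords ds R" "\<And>i j. (i, j) \<in> coord_index ds \<Longrightarrow> z (i, j) = d i \<otimes> x (i, j)"
      using proj_pointE[OF zp] by metis
    have "y \<in> hom_coords ds R"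
      using assms(1) by (simp add: proj_point_def)
    then have "z (i, j) = (d i \<otimes> inv (c i)) \<otimes> y (i, j)" if "(i, j) \<in> coord_index ds" for i j
      using that z(2)[OF that] x[OF that] inv_nonzero[OF c[of i]] d[of i] hom_coords_closed[of y ds R "(i, j)"]
      by (simp add: coord_index_iff m_assoc)
    then show "z \<in> proj_point ds R y"
      using z(1) inv_nonzero(1)[OF c] d mult_nonzero
      by (intro proj_pointI[of _ _ _ "\<lambda>i. d i \<otimes> inv (c i)"]) blast+
  qed
qed

text \<open>Each factor has its own scalar, so a family of scalars on \<open>ds @ es\<close> is a
  family on \<open>ds\<close> followed by one on \<open>es\<close>. This is why all the glued
  representatives together form a single class, so that \<open>pair_point\<close> yields a
  point.\<close>

lemma glue_proj_point:
  assumes "x \<in> hom_coords ds R" "y \<in> hom_coords es R"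
  shows "{glue ds es x' y' | x' y'. x' \<in> proj_point ds R x \<and> y' \<in> proj_point es R y} =
    proj_point (ds @ es) R (glue ds es x y)" (is "?A = ?B")
proof (intro equalityI subsetI)
  fix z assume "z \<in> ?A"
  then obtain x' y' where xp: "x' \<in> proj_point ds R x" and yp: "y' \<in> proj_point es R y"
    and z: "z = glue ds es x' y'"
    by blast
  obtain c where x': "x' \<in> hom_coords ds R" and c: "\<And>i. i < length ds \<Longrightarrow> c i \<in> carrier R - {\<zero>}"
    and x'c: "\<And>i j. (i, j) \<in> coord_index ds \<Longrightarrow> x' (i, j) = c i \<otimes> x (i, j)"
    using proj_pointE[OF xp] by metis
  obtain d where y': "y' \<in> hom_coords es R" and d: "\<And>i. i < length es \<Longrightarrow> d i \<in> carrier R - {\<zero>}"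
    and y'd: "\<And>i j. (i, j) \<in> coord_index es \<Longrightarrow> y' (i, j) = d i \<otimes> y (i, j)"
    using proj_pointE[OF yp] by metis
  define b where "b i = (if i < length ds then c i else d (i - length ds))" for i
  have "b i \<in> carrier R - {\<zero>}" if "i < length (ds @ es)" for i
    using that c[of i] d[of "i - length ds"] by (auto simp: b_def)
  moreover have "z (i, j) = b i \<otimes> glue ds es x y (i, j)" if "(i, j) \<in> coord_index (ds @ es)" for i j
    using that by (auto simp: z b_def glue_def x'c y'd coord_index_append_left coord_index_append_right)
  moreover have "z \<in> hom_coords (ds @ es) R"
    unfolding z by (rule glue_mem[OF x' y'])
  ultimately show "z \<in> ?B"
    by (intro proj_pointI) blast+
next
  fix z assume zp: "z \<in> ?B"
  obtain b where b: "\<And>i. i < length (ds @ es) \<Longrightarrow> b i \<in> carrier R - {\<zero>}"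
    and z: "z \<in> hom_coords (ds @ es) R"
    and zb: "\<And>i j. (i, j) \<in> coord_index (ds @ es) \<Longrightarrow> z (i, j) = b i \<otimes> glue ds es x y (i, j)"
    using proj_pointE[OF zp] by metis
  have "left_part ds z (i, j) = b i \<otimes> x (i, j)" if "(i, j) \<in> coord_index ds" for i j
  proof -
    have "i < length ds" "(i, j) \<in> coord_index (ds @ es)"
      using that by (auto simp: coord_index_iff nth_append)
    then show ?thesis
      using that by (simp add: left_part_def zb glue_def)
  qed
  then have "left_part ds z \<in> proj_point ds R x"
    using left_part_mem[OF z] b by (intro proj_pointI[of _ _ _ b]) auto
  moreover have "right_part ds es z (i, j) = b (i + length ds) \<otimes> y (i, j)"
    if "(i, j) \<in> coord_index es" for i j
    using that by (simp add: right_part_def zb glue_def coord_index_append_right)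
  then have "right_part ds es z \<in> proj_point es R y"
    using right_part_mem[OF z] b by (intro proj_pointI[of _ _ _ "\<lambda>i. b (i + length ds)"]) auto
  ultimately show "z \<in> ?A"
    using glue_parts[OF z] by force
qed

end

section \<open>Pairs of points and their projections\<close>

lemma pair_point_glue:
  "pair_point S T P Q = {glue (dims S) (dims T) x y | x y. x \<in> P \<and> y \<in> Q}"
  by (simp add: pair_point_def glue_def)

lemma fst_point_left: "fst_point S T R = left_part (dims S) ` R"
  by (simp add: fst_point_def left_part_def)

lemma snd_point_right: "snd_point S T R = right_part (dims S) (dims T) ` R"
  by (simp add: snd_point_def right_part_def)

text \<open>Points are sets of coordinate vectors, and a pair with an empty component is empty; so
  recovering \<open>P\<close> requires a representative of \<open>Q\<close>. \<open>P\<close> is an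
  arbitrary set of coordinate vectors, because the twin \<open>snd_point_pair\<close> is applied to
  a sum that is not yet known to lie on the curve.\<close>

lemma fst_point_pair:
  assumes "P \<subseteq> hom_coords (dims S) L" "Q \<noteq> {}"
  shows "fst_point S T (pair_point S T P Q) = P"
proof -
  have "fst_point S T (pair_point S T P Q) =
      {left_part (dims S) (glue (dims S) (dims T) x y) | x y. x \<in> P \<and> y \<in> Q}"
    unfolding fst_point_left pair_point_glue by blast
  also have "\<dots> = {x | x y. x \<in> P \<and> y \<in> Q}"
    using assms(1) left_part_glue by (metis (no_types, lifting) subsetD)
  finally show ?thesis
    using assms(2) by blast
qed

lemma snd_point_pair:
  assumes "Q \<subseteq> hom_coords (dims T) L" "P \<noteq> {}"
  shows "snd_point S T (pair_point S T P Q) = Q"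
proof -
  have "snd_point S T (pair_point S T P Q) =
      {right_part (dims S) (dims T) (glue (dims S) (dims T) x y) | x y. x \<in> P \<and> y \<in> Q}"
    unfolding snd_point_right pair_point_glue by blast
  also have "\<dots> = {y | x y. x \<in> P \<and> y \<in> Q}"
    using assms(1) right_part_glue by (metis (no_types, lifting) subsetD)
  finally show ?thesis
    using assms(2) by blast
qed

lemma var_points_subset: "P \<in> var_points k S e \<Longrightarrow> P \<subseteq> hom_coords (dims S) (fst e)"
  using proj_point_subset by (auto simp: var_points_def)

lemma var_points_nonempty:
  assumes "field (fst e)" "P \<in> var_points k S e"
  shows "P \<noteq> {}"
proof -
  interpret plain_field "fst e"
    by (rule plain_field.intro[OF assms(1)])
  obtain x where "x \<in> hom_coords (dims S) (fst e)" "P = proj_point (dims S) (fst e) x"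
    using assms(2) unfolding var_points_def by blast
  then show ?thesis
    using self_mem_proj_point by auto
qed

section \<open>Polynomials\<close>

text \<open>What evaluation depends on: finitely many monomials, coefficients in \<open>k\<close>,
  variables from \<open>I\<close>. While \<open>indexed_pset\<close> describes polynomials by how
  they are built up, this describes them by their coefficients.\<close>

definition poly_over :: "'a ring \<Rightarrow> (nat \<times> nat) set \<Rightarrow> 'a mpoly \<Rightarrow> bool" where
  "poly_over k I F \<longleftrightarrow> finite {m. F m \<noteq> \<zero>\<^bsub>k\<^esub>} \<and> (\<forall>m. F m \<in> carrier k) \<and>
     (\<forall>m. F m \<noteq> \<zero>\<^bsub>k\<^esub> \<longrightarrow> set_mset m \<subseteq> I)"

lemma poly_overD:
  assumes "poly_over k I F"
  shows "finite {m. F m \<noteq> \<zero>\<^bsub>k\<^esub>}" and "F m \<in> carrier k"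
    and "F m \<noteq> \<zero>\<^bsub>k\<^esub> \<Longrightarrow> u \<in># m \<Longrightarrow> u \<in> I"
  using assms by (auto simp: poly_over_def)

lemma (in ring) poly_over_indexed_pset:
  assumes "F \<in> indexed_pset I (carrier R)"
  shows "finite {m. F m \<noteq> \<zero>} \<and> (\<forall>m. F m \<in> carrier R) \<and> (\<forall>m. F m \<noteq> \<zero> \<longrightarrow> set_mset m \<subseteq> I)"
  using assms
proof (induction rule: indexed_pset.induct)
  case (indexed_const c)
  have "{m. indexed_const c m \<noteq> \<zero>} \<subseteq> {{#}}"
    by (auto simp: indexed_const_def)
  then show ?case
    using indexed_const by (auto simp: indexed_const_def intro: finite_subset)
next
  case (indexed_padd P Q)
  have "{m. indexed_padd P Q m \<noteq> \<zero>} \<subseteq> {m. P m \<noteq> \<zero>} \<union> {m. Q m \<noteq> \<zero>}"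
    by (auto simp: indexed_padd_def)
  then have "finite {m. indexed_padd P Q m \<noteq> \<zero>}"
    by (rule finite_subset) (use indexed_padd.IH in simp)
  moreover have "indexed_padd P Q m \<in> carrier R" for m
    using indexed_padd.IH by (simp add: indexed_padd_def)
  moreover have "set_mset m \<subseteq> I" if "indexed_padd P Q m \<noteq> \<zero>" for m
    using that indexed_padd.IH by (cases "P m = \<zero>") (auto simp: indexed_padd_def)
  ultimately show ?case
    by blast
next
  case (indexed_pmult P i)
  have "{m. indexed_pmult P i m \<noteq> \<zero>} \<subseteq> add_mset i ` {m. P m \<noteq> \<zero>}"
  proof
    fix m assume "m \<in> {m. indexed_pmult P i m \<noteq> \<zero>}"
    then have "i \<in># m" "P (m - {#i#}) \<noteq> \<zero>"
      by (auto simp: indexed_pmult_def split: if_splits)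
    then show "m \<in> add_mset i ` {m. P m \<noteq> \<zero>}"
      by (intro image_eqI[of _ _ "m - {#i#}"]) auto
  qed
  then have "finite {m. indexed_pmult P i m \<noteq> \<zero>}"
    by (rule finite_subset) (use indexed_pmult.IH in simp)
  moreover have "indexed_pmult P i m \<in> carrier R" for m
    using indexed_pmult.IH by (simp add: indexed_pmult_def)
  moreover have "set_mset m \<subseteq> I" if "indexed_pmult P i m \<noteq> \<zero>" for m
  proof -
    have "i \<in># m" "P (m - {#i#}) \<noteq> \<zero>"
      using that by (auto simp: indexed_pmult_def split: if_splits)
    then have "set_mset (m - {#i#}) \<subseteq> I" "m = add_mset i (m - {#i#})"
      using indexed_pmult.IH by simp_all
    then show ?thesis
      using indexed_pmult.hyps(2) by (metis insert_subset set_mset_add_mset_insert)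
  qed
  ultimately show ?case
    by blast
qed

lemma poly_over_multihomogeneous:
  assumes "field k" "F \<in> multihomogeneous k ds d"
  shows "poly_over k (coord_index ds) F"
proof -
  interpret field k by (rule assms(1))
  show ?thesis
    using assms(2) poly_over_indexed_pset unfolding multihomogeneous_def poly_over_def by blast
qed

lemma eval_term_closed:
  assumes "field_extension k e" "poly_over k I F" "\<And>u. u \<in> I \<Longrightarrow> x u \<in> carrier (fst e)"
    and "F m \<noteq> \<zero>\<^bsub>k\<^esub>"
  shows "(\<Otimes>\<^bsub>fst e\<^esub>u\<in>set_mset m. x u [^]\<^bsub>fst e\<^esub> count m u) \<in> carrier (fst e)"
    and "snd e (F m) \<in> carrier (fst e)"
proof -
  interpret L: plain_field "fst e"
    using assms(1) by (simp add: plain_field_def field_extension_def)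
  show "(\<Otimes>\<^bsub>fst e\<^esub>u\<in>set_mset m. x u [^]\<^bsub>fst e\<^esub> count m u) \<in> carrier (fst e)"
    using assms(3) poly_overD(3)[OF assms(2,4)] by (intro L.finprod_closed Pi_I L.nat_pow_closed) blast
  show "snd e (F m) \<in> carrier (fst e)"
    using assms(1) poly_overD(2)[OF assms(2)] by (auto simp: field_extension_def intro: ring_hom_closed)
qed

lemma poly_eval_closed:
  assumes "field_extension k e" "poly_over k I F" "\<And>u. u \<in> I \<Longrightarrow> x u \<in> carrier (fst e)"
  shows "poly_eval k e F x \<in> carrier (fst e)"
proof -
  interpret L: plain_field "fst e"
    using assms(1) by (simp add: plain_field_def field_extension_def)
  show ?thesis
    unfolding poly_eval_def
    by (intro L.finsum_closed Pi_I L.m_closed eval_term_closed[OF assms(1,2)] assms(3)) auto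
qed

lemma poly_eval_cong:
  assumes "field_extension k e" "poly_over k I F" "\<And>u. u \<in> I \<Longrightarrow> y u \<in> carrier (fst e)"
    and "\<And>u. u \<in> I \<Longrightarrow> x u = y u"
  shows "poly_eval k e F x = poly_eval k e F y"
proof -
  interpret L: plain_field "fst e"
    using assms(1) by (simp add: plain_field_def field_extension_def)
  have "(\<Otimes>\<^bsub>fst e\<^esub>u\<in>set_mset m. x u [^]\<^bsub>fst e\<^esub> count m u) =
      (\<Otimes>\<^bsub>fst e\<^esub>u\<in>set_mset m. y u [^]\<^bsub>fst e\<^esub> count m u)" if "F m \<noteq> \<zero>\<^bsub>k\<^esub>" for m
    using assms(3,4) poly_overD(3)[OF assms(2) that]
    by (intro L.finprod_cong' Pi_I L.nat_pow_closed) simp_all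
  then show ?thesis
    unfolding poly_eval_def
    by (intro L.finsum_cong' Pi_I L.m_closed eval_term_closed[OF assms(1,2)] assms(3)) auto
qed

text \<open>A variable that occurs in a monomial has a positive exponent, so its vanishing kills the
  monomial. Meant for the point at infinity, where every term of the Weierstrass polynomial dies in
  this way.\<close>

lemma poly_eval_eq_zero:
  assumes "field_extension k e" "poly_over k I F" "\<And>u. u \<in> I \<Longrightarrow> x u \<in> carrier (fst e)"
    and "\<And>m. F m \<noteq> \<zero>\<^bsub>k\<^esub> \<Longrightarrow> \<exists>u\<in>#m. x u = \<zero>\<^bsub>fst e\<^esub>"
  shows "poly_eval k e F x = \<zero>\<^bsub>fst e\<^esub>"
proof -
  interpret L: plain_field "fst e"
    using assms(1) by (simp add: plain_field_def field_extension_def)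
  have "(\<Otimes>\<^bsub>fst e\<^esub>u\<in>set_mset m. x u [^]\<^bsub>fst e\<^esub> count m u) = \<zero>\<^bsub>fst e\<^esub>"
    if m: "F m \<noteq> \<zero>\<^bsub>k\<^esub>" for m
  proof -
    obtain u where u: "u \<in># m" "x u = \<zero>\<^bsub>fst e\<^esub>"
      using assms(4)[OF m] by blast
    have cl: "x w [^]\<^bsub>fst e\<^esub> count m w \<in> carrier (fst e)" if "w \<in># m" for w
      using assms(3) poly_overD(3)[OF assms(2) m that] by simp
    have "(\<Otimes>\<^bsub>fst e\<^esub>u\<in>insert u (set_mset m - {u}). x u [^]\<^bsub>fst e\<^esub> count m u) =
        x u [^]\<^bsub>fst e\<^esub> count m u \<otimes>\<^bsub>fst e\<^esub>
        (\<Otimes>\<^bsub>fst e\<^esub>u\<in>set_mset m - {u}. x u [^]\<^bsub>fst e\<^esub> count m u)"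
      using cl u(1) by (intro L.finprod_insert) auto
    also have "x u [^]\<^bsub>fst e\<^esub> count m u = \<zero>\<^bsub>fst e\<^esub>"
      using u by (simp add: L.nat_pow_zero)
    also have "\<zero>\<^bsub>fst e\<^esub> \<otimes>\<^bsub>fst e\<^esub> (\<Otimes>\<^bsub>fst e\<^esub>u\<in>set_mset m - {u}. x u [^]\<^bsub>fst e\<^esub> count m u) = \<zero>\<^bsub>fst e\<^esub>"
      using cl by (intro L.l_null L.finprod_closed) auto
    also have "insert u (set_mset m - {u}) = set_mset m"
      using u(1) by blast
    finally show ?thesis .
  qed
  then show ?thesis
    unfolding poly_eval_def using eval_term_closed(2)[OF assms(1-2), of x] assms(3)
    by (intro L.add.finprod_one_eqI) simp
qed

text \<open>Truncated subtraction of \<open>n\<close> undoes the shift of indices only if all of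
  them are at least \<open>n\<close>, which is the guard in \<open>shift_poly\<close>. So the
  exponents of the shifted polynomial are exactly the shifted exponents of \<open>F\<close>, with
  unchanged coefficients.\<close>

lemma shift_poly_support:
  "{m. shift_poly k n F m \<noteq> \<zero>\<^bsub>k\<^esub>} = image_mset (\<lambda>(i, j). (i + n, j)) ` {m. F m \<noteq> \<zero>\<^bsub>k\<^esub>}"
    (is "?A = image_mset ?\<sigma> ` ?B")
  and shift_poly_image: "shift_poly k n F (image_mset (\<lambda>(i, j). (i + n, j)) m) = F m"
proof -
  let ?\<tau> = "\<lambda>(i, j). (i - n, j :: nat)"
  have id: "image_mset ?\<tau> (image_mset ?\<sigma> m) = m" for m :: "(nat \<times> nat) multiset"
    by (simp add: image_mset.compositionality o_def case_prod_unfold)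
  then show image: "shift_poly k n F (image_mset ?\<sigma> m) = F m" for m
    by (auto simp: shift_poly_def)
  have "m \<in> image_mset ?\<sigma> ` ?B" if "m \<in> ?A" for m
  proof
    have le: "\<forall>u\<in>#m. n \<le> fst u" and "F (image_mset ?\<tau> m) \<noteq> \<zero>\<^bsub>k\<^esub>"
      using that by (auto simp: shift_poly_def split: if_splits)
    then show "image_mset ?\<tau> m \<in> ?B"
      by simp
    have "image_mset ?\<sigma> (image_mset ?\<tau> m) = image_mset (\<lambda>u. u) m"
      unfolding image_mset.compositionality using le by (intro image_mset_cong) auto
    then show "m = image_mset ?\<sigma> (image_mset ?\<tau> m)"
      by simp
  qed
  then show "?A = image_mset ?\<sigma> ` ?B"
    using image by auto
qed

lemma count_shift: "count (image_mset (\<lambda>(i, j). (i + n, j)) m) (i + n :: nat, j) = count m (i, j)"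
  by (induction m) auto

lemma poly_over_shift:
  assumes "field k" "poly_over k (coord_index es) F"
  shows "poly_over k (coord_index (ds @ es)) (shift_poly k (length ds) F)"
  unfolding poly_over_def
proof (intro conjI allI impI)
  show "finite {m. shift_poly k (length ds) F m \<noteq> \<zero>\<^bsub>k\<^esub>}"
    using assms by (simp add: shift_poly_support poly_over_def)
  fix m
  show "shift_poly k (length ds) F m \<in> carrier k"
    using assms(1) poly_overD(2)[OF assms(2)]
    by (simp add: shift_poly_def cring.cring_simprules(2) fieldE(1))
  assume "shift_poly k (length ds) F m \<noteq> \<zero>\<^bsub>k\<^esub>"
  then obtain m' where "F m' \<noteq> \<zero>\<^bsub>k\<^esub>" "m = image_mset (\<lambda>(i, j). (i + length ds, j)) m'"
    using shift_poly_support[of k "length ds" F] by blast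
  then show "set_mset m \<subseteq> coord_index (ds @ es)"
    using poly_overD(3)[OF assms(2)] by (auto simp: coord_index_append_right)
qed

text \<open>The shift of indices is injective on variables and hence on monomials; the product over
  the variables and the sum over the monomials are both reindexed along it.\<close>

lemma poly_eval_shift:
  assumes "field_extension k e" "poly_over k (coord_index es) F"
    and "z \<in> hom_coords (ds @ es) (fst e)"
  shows "poly_eval k e (shift_poly k (length ds) F) z = poly_eval k e F (right_part ds es z)"
proof -
  let ?n = "length ds"
  let ?\<sigma> = "\<lambda>(i, j). (i + ?n, j :: nat)"
  let ?t = "\<lambda>m. snd e (shift_poly k ?n F m) \<otimes>\<^bsub>fst e\<^esub>
    (\<Otimes>\<^bsub>fst e\<^esub>u\<in>set_mset m. z u [^]\<^bsub>fst e\<^esub> count m u)"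
  interpret L: plain_field "fst e"
    using assms(1) by (simp add: plain_field_def field_extension_def)
  have y: "right_part ds es z u \<in> carrier (fst e)" if "u \<in> coord_index es" for u
    using hom_coords_closed[OF right_part_mem[OF assms(3)] that] .
  have z: "z (?\<sigma> u) = right_part ds es z u" if "u \<in> coord_index es" for u
    using that by (auto simp: right_part_def)
  have inj: "inj ?\<sigma>"
    by (auto simp: inj_on_def)
  have prod: "(\<Otimes>\<^bsub>fst e\<^esub>u\<in>set_mset (image_mset ?\<sigma> m). z u [^]\<^bsub>fst e\<^esub> count (image_mset ?\<sigma> m) u) =
      (\<Otimes>\<^bsub>fst e\<^esub>u\<in>set_mset m. right_part ds es z u [^]\<^bsub>fst e\<^esub> count m u)" if "F m \<noteq> \<zero>\<^bsub>k\<^esub>" for m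
  proof -
    have m: "u \<in> coord_index es" if "u \<in># m" for u
      using poly_overD(3)[OF assms(2) \<open>F m \<noteq> \<zero>\<^bsub>k\<^esub>\<close> that] .
    have "(\<Otimes>\<^bsub>fst e\<^esub>u\<in>?\<sigma> ` set_mset m. z u [^]\<^bsub>fst e\<^esub> count (image_mset ?\<sigma> m) u) =
        (\<Otimes>\<^bsub>fst e\<^esub>u\<in>set_mset m. z (?\<sigma> u) [^]\<^bsub>fst e\<^esub> count (image_mset ?\<sigma> m) (?\<sigma> u))"
      using inj y z m by (intro L.finprod_reindex) (auto simp: inj_on_def)
    also have "\<dots> = (\<Otimes>\<^bsub>fst e\<^esub>u\<in>set_mset m. right_part ds es z u [^]\<^bsub>fst e\<^esub> count m u)"
      using y z m by (intro L.finprod_cong') (auto simp: count_shift)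
    finally show ?thesis
      by simp
  qed
  have cl: "snd e (F m) \<otimes>\<^bsub>fst e\<^esub>
      (\<Otimes>\<^bsub>fst e\<^esub>u\<in>set_mset m. right_part ds es z u [^]\<^bsub>fst e\<^esub> count m u) \<in> carrier (fst e)"
    if "F m \<noteq> \<zero>\<^bsub>k\<^esub>" for m
    using eval_term_closed[OF assms(1,2) y that] by simp
  have "poly_eval k e (shift_poly k ?n F) z = (\<Oplus>\<^bsub>fst e\<^esub>m\<in>image_mset ?\<sigma> ` {m. F m \<noteq> \<zero>\<^bsub>k\<^esub>}. ?t m)"
    by (simp add: poly_eval_def shift_poly_support)
  also have "\<dots> = (\<Oplus>\<^bsub>fst e\<^esub>m\<in>{m. F m \<noteq> \<zero>\<^bsub>k\<^esub>}. ?t (image_mset ?\<sigma> m))"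
  proof (rule L.finsum_reindex)
    show "?t \<in> image_mset ?\<sigma> ` {m. F m \<noteq> \<zero>\<^bsub>k\<^esub>} \<rightarrow> carrier (fst e)"
      using cl by (auto simp: shift_poly_image prod simp del: set_image_mset)
    show "inj_on (image_mset ?\<sigma>) {m. F m \<noteq> \<zero>\<^bsub>k\<^esub>}"
      using multiset.inj_map[OF inj] by (rule inj_on_subset) simp
  qed
  also have "\<dots> = poly_eval k e F (right_part ds es z)"
    unfolding poly_eval_def using cl
    by (intro L.finsum_cong') (auto simp: shift_poly_image prod simp del: set_image_mset)
  finally show ?thesis .
qed

section \<open>Base change\<close>

text \<open>The embedding into \<open>fst e\<close> of the copy of \<open>k\<close> made by
  \<open>base_extension\<close>: strip the singleton, then apply the given embedding. It is the map
  that \<open>base_change\<close> applies to each coordinate.\<close>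

definition scalar_map :: "'a ring \<Rightarrow> 'a extension \<Rightarrow> (nat \<Rightarrow> 'a) set \<Rightarrow> (nat \<Rightarrow> 'a) set" where
  "scalar_map k e c = snd e (inv_into (carrier k) (snd (base_extension k)) c)"

definition coords_map :: "'a ring \<Rightarrow> 'a extension \<Rightarrow> nat list \<Rightarrow>
    (nat \<times> nat \<Rightarrow> (nat \<Rightarrow> 'a) set) \<Rightarrow> nat \<times> nat \<Rightarrow> (nat \<Rightarrow> 'a) set" where
  "coords_map k e ds x = (\<lambda>u\<in>coord_index ds. scalar_map k e (x u))"

locale extension_field = k: field k for k :: "'a ring" +
  fixes e :: "'a extension"
  assumes field_extension: "field_extension k e"
begin

abbreviation "K \<equiv> fst (base_extension k)"
abbreviation "L \<equiv> fst e"
abbreviation "h \<equiv> scalar_map k e"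

lemma base_extension_iso: "snd (base_extension k) \<in> ring_iso k K"
proof -
  have "inj_on (\<lambda>x. {\<lambda>n::nat. x}) (carrier k)"
    by (auto simp: inj_on_def fun_eq_iff)
  then show ?thesis
    by (simp add: base_extension_def inj_imp_image_ring_iso)
qed

lemma field_extension_K: "field_extension k (base_extension k)"
  by (rule field_extension_base[OF k.field_axioms])

lemma field_K: "field K"
  using field_extension_K by (simp add: field_extension_def)

lemma field_L: "field L"
  using field_extension by (simp add: field_extension_def)

sublocale K: plain_field K by (rule plain_field.intro[OF field_K])
sublocale L: plain_field L by (rule plain_field.intro[OF field_L])

lemma scalar_map_hom: "h \<in> ring_hom K L"
proof -
  have "inv_into (carrier k) (snd (base_extension k)) \<in> ring_hom K k"
    using ring_iso_set_sym[OF k.ring_axioms base_extension_iso] by (simp add: ring_iso_def)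
  then have "snd e \<circ> inv_into (carrier k) (snd (base_extension k)) \<in> ring_hom K L"
    using field_extension by (intro ring_hom_trans) (auto simp: field_extension_def)
  then show ?thesis
    by (simp add: scalar_map_def[abs_def] o_def)
qed

sublocale ring_hom_cring K L h
  by unfold_locales (rule scalar_map_hom)

lemma scalar_map_base: "c \<in> carrier k \<Longrightarrow> h (snd (base_extension k) c) = snd e c"
  using base_extension_iso by (simp add: scalar_map_def ring_iso_def bij_betw_def inv_into_f_f)

text \<open>A homomorphism of fields is injective. This carries nonvanishing conditions to the
  extension: coordinates that are not all zero, inequations, and the validity of a local expression
  of a morphism.\<close>

lemma scalar_map_eq_0_iff: "c \<in> carrier K \<Longrightarrow> h c = \<zero>\<^bsub>L\<^esub> \<longleftrightarrow> c = \<zero>\<^bsub>K\<^esub>"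
  using non_trivial_field_hom_is_inj[OF scalar_map_hom field_K field_L]
  by (metis K.zero_closed hom_zero inj_on_eq_iff)

lemma coords_map_mem:
  assumes "x \<in> hom_coords ds K"
  shows "coords_map k e ds x \<in> hom_coords ds L"
proof (rule hom_coordsI)
  fix i assume i: "i < length ds"
  then obtain j where j: "j \<le> ds ! i" "x (i, j) \<noteq> \<zero>\<^bsub>K\<^esub>"
    using hom_coords_nonzero[OF assms] by blast
  then show "\<exists>j\<le>ds ! i. coords_map k e ds x (i, j) \<noteq> \<zero>\<^bsub>L\<^esub>"
    using i hom_coords_closed[OF assms, of "(i, j)"]
    by (intro exI[of _ j]) (auto simp: coords_map_def coord_index_iff scalar_map_eq_0_iff)
qed (use hom_coords_closed[OF assms] in \<open>auto simp: coords_map_def\<close>)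

text \<open>\<open>base_change\<close> is a union over all representatives. Proportional vectors go
  to proportional vectors, with scalars \<open>h (c i)\<close> that are nonzero by injectivity, so
  all classes in the union coincide.\<close>

lemma base_change_proj_point:
  assumes "x \<in> hom_coords (dims S) K"
  shows "base_change k S e (proj_point (dims S) K x) = proj_point (dims S) L (coords_map k e (dims S) x)"
proof -
  have "proj_point (dims S) L (coords_map k e (dims S) y) =
      proj_point (dims S) L (coords_map k e (dims S) x)" if y: "y \<in> proj_point (dims S) K x" for y
  proof -
    obtain c where c: "\<And>i. i < length (dims S) \<Longrightarrow> c i \<in> carrier K - {\<zero>\<^bsub>K\<^esub>}"
      and yc: "\<And>i j. (i, j) \<in> coord_index (dims S) \<Longrightarrow> y (i, j) = c i \<otimes>\<^bsub>K\<^esub> x (i, j)"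
      and y': "y \<in> hom_coords (dims S) K"
      using proj_pointE[OF y] by metis
    have "coords_map k e (dims S) y (i, j) = h (c i) \<otimes>\<^bsub>L\<^esub> coords_map k e (dims S) x (i, j)"
      if "(i, j) \<in> coord_index (dims S)" for i j
      using that yc[OF that] c[of i] hom_coords_closed[OF assms that]
      by (simp add: coords_map_def coord_index_iff)
    moreover have "h (c i) \<in> carrier L - {\<zero>\<^bsub>L\<^esub>}" if "i < length (dims S)" for i
      using c[OF that] by (simp add: scalar_map_eq_0_iff)
    ultimately have "coords_map k e (dims S) y \<in> proj_point (dims S) L (coords_map k e (dims S) x)"
      using coords_map_mem[OF y'] by (intro proj_pointI[of _ _ _ "\<lambda>i. h (c i)"]) auto
    then show ?thesis
      by (rule L.proj_point_eq[OF _ coords_map_mem[OF assms]])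
  qed
  moreover have "x \<in> proj_point (dims S) K x"
    by (rule K.self_mem_proj_point[OF assms])
  ultimately show ?thesis
    unfolding base_change_def coords_map_def scalar_map_def by blast
qed

text \<open>A ring homomorphism passes through the finite sum and the products, and \<open>h\<close>
  sends the copy of a coefficient in \<open>K\<close> to its image in \<open>L\<close>.\<close>

lemma poly_eval_coords_map:
  assumes "poly_over k (coord_index ds) F" "x \<in> hom_coords ds K"
  shows "poly_eval k e F (coords_map k e ds x) = h (poly_eval k (base_extension k) F x)"
proof -
  let ?b = "base_extension k"
  let ?t = "\<lambda>m. snd ?b (F m) \<otimes>\<^bsub>K\<^esub> (\<Otimes>\<^bsub>K\<^esub>u\<in>set_mset m. x u [^]\<^bsub>K\<^esub> count m u)"
  let ?t' = "\<lambda>m. snd e (F m) \<otimes>\<^bsub>L\<^esub> (\<Otimes>\<^bsub>L\<^esub>u\<in>set_mset m. coords_map k e ds x u [^]\<^bsub>L\<^esub> count m u)"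
  have x: "x u \<in> carrier K" and x': "coords_map k e ds x u \<in> carrier L" if "u \<in> coord_index ds" for u
    using that hom_coords_closed[OF assms(2)] hom_coords_closed[OF coords_map_mem[OF assms(2)]] by auto
  have cl: "snd ?b (F m) \<in> carrier K" "(\<Otimes>\<^bsub>K\<^esub>u\<in>set_mset m. x u [^]\<^bsub>K\<^esub> count m u) \<in> carrier K"
    and cl': "?t' m \<in> carrier L" if "F m \<noteq> \<zero>\<^bsub>k\<^esub>" for m
    using that eval_term_closed[OF field_extension_K assms(1), of x m] x
      eval_term_closed[OF field_extension assms(1), of "coords_map k e ds x" m] x' by auto
  have t: "h (?t m) = ?t' m" if "F m \<noteq> \<zero>\<^bsub>k\<^esub>" for m
  proof -
    have m: "u \<in> coord_index ds" if "u \<in># m" for u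
      using poly_overD(3)[OF assms(1) \<open>F m \<noteq> \<zero>\<^bsub>k\<^esub>\<close> that] .
    have "h (\<Otimes>\<^bsub>K\<^esub>u\<in>set_mset m. x u [^]\<^bsub>K\<^esub> count m u) =
        (\<Otimes>\<^bsub>L\<^esub>u\<in>set_mset m. (h \<circ> (\<lambda>u. x u [^]\<^bsub>K\<^esub> count m u)) u)"
      using x m by (intro hom_finprod) simp
    also have "\<dots> = (\<Otimes>\<^bsub>L\<^esub>u\<in>set_mset m. coords_map k e ds x u [^]\<^bsub>L\<^esub> count m u)"
      using x x' m by (intro L.finprod_cong') (simp_all add: coords_map_def)
    finally show ?thesis
      using cl[OF that] assms(1) by (simp add: scalar_map_base poly_over_def)
  qed
  have "h (poly_eval k ?b F x) = (\<Oplus>\<^bsub>L\<^esub>m\<in>{m. F m \<noteq> \<zero>\<^bsub>k\<^esub>}. (h \<circ> ?t) m)"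
    unfolding poly_eval_def using cl by (intro hom_finsum) auto
  also have "\<dots> = poly_eval k e F (coords_map k e ds x)"
    unfolding poly_eval_def using cl' t by (intro L.finsum_cong') auto
  finally show ?thesis ..
qed

end

text \<open>The condition on the defining polynomials on which evaluation and base change rest. For
  \<open>G\<close> it comes from \<open>is_variety\<close>; for the multiplicative group and the
  curve it is checked directly, and for their product it follows by renaming variables.\<close>

definition poly_variety :: "'a ring \<Rightarrow> 'a variety \<Rightarrow> bool" where
  "poly_variety k S \<longleftrightarrow>
     (\<forall>F \<in> equations S \<union> (\<Union>U\<in>inequations S. U). poly_over k (coord_index (dims S)) F)"

lemma poly_varietyD:
  assumes "poly_variety k S"
  shows "F \<in> equations S \<Longrightarrow> poly_over k (coord_index (dims S)) F"
    and "U \<in> inequations S \<Longrightarrow> F \<in> U \<Longrightarrow> poly_over k (coord_index (dims S)) F"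
  using assms by (auto simp: poly_variety_def)

lemma poly_variety_is_variety: "field k \<Longrightarrow> is_variety k S \<Longrightarrow> poly_variety k S"
  unfolding is_variety_def poly_variety_def using poly_over_multihomogeneous by blast

lemma var_pointsE:
  assumes "P \<in> var_points k S e"
  obtains x where "x \<in> hom_coords (dims S) (fst e)" "P = proj_point (dims S) (fst e) x"
    and "\<And>F. F \<in> equations S \<Longrightarrow> poly_eval k e F x = \<zero>\<^bsub>fst e\<^esub>"
    and "\<And>U. U \<in> inequations S \<Longrightarrow> \<exists>F\<in>U. poly_eval k e F x \<noteq> \<zero>\<^bsub>fst e\<^esub>"
  using assms by (auto simp: var_points_def)

lemma var_pointsI:
  assumes "x \<in> hom_coords (dims S) (fst e)"
    and "\<And>F. F \<in> equations S \<Longrightarrow> poly_eval k e F x = \<zero>\<^bsub>fst e\<^esub>"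
    and "\<And>U. U \<in> inequations S \<Longrightarrow> \<exists>F\<in>U. poly_eval k e F x \<noteq> \<zero>\<^bsub>fst e\<^esub>"
  shows "proj_point (dims S) (fst e) x \<in> var_points k S e"
  using assms by (auto simp: var_points_def)

section \<open>Base change of points, morphisms and pairs\<close>

context extension_field
begin

lemma coords_map_var_points:
  assumes "poly_variety k S" "x \<in> hom_coords (dims S) K"
    and "\<And>F. F \<in> equations S \<Longrightarrow> poly_eval k (base_extension k) F x = \<zero>\<^bsub>K\<^esub>"
    and "\<And>U. U \<in> inequations S \<Longrightarrow> \<exists>F\<in>U. poly_eval k (base_extension k) F x \<noteq> \<zero>\<^bsub>K\<^esub>"
  shows "proj_point (dims S) L (coords_map k e (dims S) x) \<in> var_points k S e"
proof (rule var_pointsI)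
  show "coords_map k e (dims S) x \<in> hom_coords (dims S) L"
    by (rule coords_map_mem[OF assms(2)])
  show "poly_eval k e F (coords_map k e (dims S) x) = \<zero>\<^bsub>L\<^esub>" if "F \<in> equations S" for F
    using poly_eval_coords_map[OF poly_varietyD(1)[OF assms(1) that] assms(2)] assms(3)[OF that] by simp
  fix U assume U: "U \<in> inequations S"
  then obtain F where F: "F \<in> U" "poly_eval k (base_extension k) F x \<noteq> \<zero>\<^bsub>K\<^esub>"
    using assms(4) by blast
  note pF = poly_varietyD(2)[OF assms(1) U F(1)]
  have "poly_eval k (base_extension k) F x \<in> carrier K"
    using poly_eval_closed[OF field_extension_K pF] hom_coords_closed[OF assms(2)] by blast
  then have "poly_eval k e F (coords_map k e (dims S) x) \<noteq> \<zero>\<^bsub>L\<^esub>"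
    using poly_eval_coords_map[OF pF assms(2)] F(2) by (simp add: scalar_map_eq_0_iff)
  then show "\<exists>F\<in>U. poly_eval k e F (coords_map k e (dims S) x) \<noteq> \<zero>\<^bsub>L\<^esub>"
    using F(1) by blast
qed

lemma base_change_closed:
  assumes "poly_variety k S" "P \<in> var_points k S (base_extension k)"
  shows "base_change k S e P \<in> var_points k S e"
proof -
  obtain x where x: "x \<in> hom_coords (dims S) K" "P = proj_point (dims S) K x"
    and eq: "\<And>F. F \<in> equations S \<Longrightarrow> poly_eval k (base_extension k) F x = \<zero>\<^bsub>K\<^esub>"
    and ineq: "\<And>U. U \<in> inequations S \<Longrightarrow> \<exists>F\<in>U. poly_eval k (base_extension k) F x \<noteq> \<zero>\<^bsub>K\<^esub>"
    using var_pointsE[OF assms(2)] by metis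
  show ?thesis
    unfolding x(2) base_change_proj_point[OF x(1)]
    by (rule coords_map_var_points[OF assms(1) x(1) eq ineq])
qed

text \<open>Pick a local expression \<open>A\<close> that describes \<open>f\<close> at a
  representative \<open>x\<close>. Its entries are polynomials over \<open>k\<close>, so its values
  at the image of \<open>x\<close> are the images of its values at \<open>x\<close>. By injectivity
  they again do not all vanish on any factor of the target. Hence the same \<open>A\<close>
  describes \<open>f\<close> at the point after base change, and its value there is the base change
  of the value of \<open>f\<close> at \<open>P\<close>.\<close>

lemma base_change_regular_map:
  assumes "poly_variety k S" "regular_map k S T f" "P \<in> var_points k S (base_extension k)"
  shows "f e (base_change k S e P) = base_change k T e (f (base_extension k) P)"
proof -
  let ?b = "base_extension k"
  obtain x where x: "x \<in> hom_coords (dims S) K" "P = proj_point (dims S) K x"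
    and eq: "\<And>F. F \<in> equations S \<Longrightarrow> poly_eval k ?b F x = \<zero>\<^bsub>K\<^esub>"
    and ineq: "\<And>U. U \<in> inequations S \<Longrightarrow> \<exists>F\<in>U. poly_eval k ?b F x \<noteq> \<zero>\<^bsub>K\<^esub>"
    using var_pointsE[OF assms(3)] by metis
  let ?x = "coords_map k e (dims S) x"
  obtain \<Phi> where \<Phi>: "\<forall>A\<in>\<Phi>. \<forall>i<length (dims T). \<exists>d. \<forall>j\<le>dims T ! i.
        A (i, j) \<in> multihomogeneous k (dims S) d"
    and charts: "\<forall>e. field_extension k e \<longrightarrow> (\<forall>P\<in>var_points k S e. \<forall>x\<in>P.
        (\<exists>A\<in>\<Phi>. eval_chart k e (dims T) A x \<in> hom_coords (dims T) (fst e)) \<and>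
        (\<forall>A\<in>\<Phi>. eval_chart k e (dims T) A x \<in> hom_coords (dims T) (fst e) \<longrightarrow>
           f e P = proj_point (dims T) (fst e) (eval_chart k e (dims T) A x)))"
    using assms(2) unfolding regular_map_def by (elim conjE exE)
  have chart: "f e P = proj_point (dims T) (fst e) (eval_chart k e (dims T) A x)"
    if "field_extension k e" "P \<in> var_points k S e" "x \<in> P" "A \<in> \<Phi>"
      "eval_chart k e (dims T) A x \<in> hom_coords (dims T) (fst e)" for e P x A
    using charts that by blast
  have xP: "x \<in> P"
    using x K.self_mem_proj_point by simp
  obtain A where A: "A \<in> \<Phi>" and Ax: "eval_chart k ?b (dims T) A x \<in> hom_coords (dims T) K"
    using charts field_extension_K assms(3) xP by blast
  have fP: "f ?b P = proj_point (dims T) K (eval_chart k ?b (dims T) A x)"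
    by (rule chart[OF field_extension_K assms(3) xP A Ax])
  have "coords_map k e (dims T) (eval_chart k ?b (dims T) A x) u = eval_chart k e (dims T) A ?x u" for u
  proof (cases "u \<in> coord_index (dims T)")
    case True
    then obtain i j where u: "u = (i, j)" "i < length (dims T)" "j \<le> dims T ! i"
      by (cases u) (auto simp: coord_index_iff)
    then have "poly_over k (coord_index (dims S)) (A u)"
      using \<Phi> A u poly_over_multihomogeneous[OF k.field_axioms] by blast
    then show ?thesis
      using True x(1) by (simp add: coords_map_def[of k e "dims T"] eval_chart_def poly_eval_coords_map)
  qed (simp add: coords_map_def eval_chart_def)
  then have Ax': "coords_map k e (dims T) (eval_chart k ?b (dims T) A x) = eval_chart k e (dims T) A ?x"
    by (rule ext)
  have bc: "base_change k S e P = proj_point (dims S) L ?x"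
    unfolding x(2) by (rule base_change_proj_point[OF x(1)])
  have "f e (base_change k S e P) = proj_point (dims T) L (eval_chart k e (dims T) A ?x)"
  proof (rule chart[OF field_extension _ _ A])
    show "base_change k S e P \<in> var_points k S e"
      unfolding bc by (rule coords_map_var_points[OF assms(1) x(1) eq ineq])
    show "?x \<in> base_change k S e P"
      unfolding bc by (intro L.self_mem_proj_point coords_map_mem x(1))
    show "eval_chart k e (dims T) A ?x \<in> hom_coords (dims T) L"
      unfolding Ax'[symmetric] by (rule coords_map_mem[OF Ax])
  qed
  then show ?thesis
    unfolding fP base_change_proj_point[OF Ax] Ax' .
qed

lemma coords_map_glue:
  "coords_map k e (ds @ es) (glue ds es x y) = glue ds es (coords_map k e ds x) (coords_map k e es y)"
proof
  fix u show "coords_map k e (ds @ es) (glue ds es x y) u =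
      glue ds es (coords_map k e ds x) (coords_map k e es y) u"
    by (cases u; cases "fst u < length ds")
      (auto simp: coords_map_def glue_def coord_index_append_left coord_index_append_right)
qed

text \<open>Gluing only rearranges coordinates, so it commutes with a map that is applied to each of
  them.\<close>

lemma base_change_pair_point:
  assumes "P \<in> var_points k S (base_extension k)" "Q \<in> var_points k T (base_extension k)"
  shows "base_change k (var_prod k S T) e (pair_point S T P Q) =
    pair_point S T (base_change k S e P) (base_change k T e Q)"
proof -
  obtain x where x: "x \<in> hom_coords (dims S) K" "P = proj_point (dims S) K x"
    using var_pointsE[OF assms(1)] by metis
  obtain y where y: "y \<in> hom_coords (dims T) K" "Q = proj_point (dims T) K y"
    using var_pointsE[OF assms(2)] by metis
  have dims: "dims (var_prod k S T) = dims S @ dims T"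
    by (simp add: var_prod_def Let_def)
  have "pair_point S T P Q = proj_point (dims S @ dims T) K (glue (dims S) (dims T) x y)"
    using K.glue_proj_point[OF x(1) y(1)] by (simp add: pair_point_glue x(2) y(2))
  then have "base_change k (var_prod k S T) e (pair_point S T P Q) = proj_point (dims S @ dims T) L
      (coords_map k e (dims S @ dims T) (glue (dims S) (dims T) x y))"
    using base_change_proj_point[of "glue (dims S) (dims T) x y" "var_prod k S T"] glue_mem[OF x(1) y(1)]
    by (simp add: dims)
  then show ?thesis
    using L.glue_proj_point[OF coords_map_mem[OF x(1)] coords_map_mem[OF y(1)]]
    by (simp add: pair_point_glue x y base_change_proj_point coords_map_glue)
qed

text \<open>Meant for the neutral elements of the multiplicative group and of the curve, whose
  coordinates are zeros and ones and are sent by \<open>h\<close> to zeros and ones. A projective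
  space of dimension d has d + 1 coordinates, hence \<open>length cs - 1\<close>; for empty
  \<open>cs\<close> this difference would be truncated.\<close>

lemma base_change_coord_vec:
  assumes "dims S = [length cs - 1]" "coord_vec cs \<in> hom_coords (dims S) K" "cs \<noteq> []"
  shows "base_change k S e (proj_point (dims S) K (coord_vec cs)) =
    proj_point (dims S) L (coord_vec (map h cs))"
proof -
  have "(i, j) \<in> coord_index (dims S) \<longleftrightarrow> i = 0 \<and> j < length cs" for i j
    using assms(1,3) by (cases cs) (auto simp: coord_index_iff)
  then have "coords_map k e (dims S) (coord_vec cs) = coord_vec (map h cs)"
    by (intro ext) (auto simp: coords_map_def coord_vec_def)
  then show ?thesis
    using base_change_proj_point[OF assms(2)] by simp
qed

end

section \<open>Products\<close>

lemma var_prod_simps [simp]: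
  "dims (var_prod k S T) = dims S @ dims T"
  "equations (var_prod k S T) = equations S \<union> shift_poly k (length (dims S)) ` equations T"
  "inequations (var_prod k S T) =
     inequations S \<union> (\<lambda>U. shift_poly k (length (dims S)) ` U) ` inequations T"
  by (simp_all add: var_prod_def Let_def)

lemma poly_variety_prod:
  assumes "field k" "poly_variety k S" "poly_variety k T"
  shows "poly_variety k (var_prod k S T)"
proof -
  have "poly_over k (coord_index (dims S @ dims T)) F" if "poly_over k (coord_index (dims S)) F" for F
    using that coord_index_subset_append[of "dims S" "dims T"] unfolding poly_over_def by blast
  then show ?thesis
    using poly_varietyD[OF assms(2)] poly_over_shift[OF assms(1) poly_varietyD(1)[OF assms(3)]]
      poly_over_shift[OF assms(1) poly_varietyD(2)[OF assms(3)]]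
    by (fastforce simp: poly_variety_def)
qed

text \<open>A polynomial of \<open>S\<close> sees only the left part of a coordinate vector, and a
  shifted polynomial of \<open>T\<close> only the right part. So the conditions on a vector
  separate, and by \<open>glue_proj_point\<close> its class is the pair of the classes of its
  parts.\<close>

lemma var_points_prod:
  assumes "field_extension k e" "poly_variety k S" "poly_variety k T"
  shows "var_points k (var_prod k S T) e =
    {pair_point S T P Q | P Q. P \<in> var_points k S e \<and> Q \<in> var_points k T e}"
proof -
  interpret L: plain_field "fst e"
    using assms(1) by (simp add: plain_field_def field_extension_def)
  let ?n = "length (dims S)"
  let ?l = "left_part (dims S)" and ?r = "right_part (dims S) (dims T)"
  have left: "poly_eval k e F z = poly_eval k e F (?l z)"
    if "poly_over k (coord_index (dims S)) F" "z \<in> hom_coords (dims S @ dims T) (fst e)" for F z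
    using hom_coords_closed[OF left_part_mem[OF that(2)]]
    by (intro poly_eval_cong[OF assms(1) that(1)]) (auto simp: left_part_def)
  have right: "poly_eval k e (shift_poly k ?n F) z = poly_eval k e F (?r z)"
    if "poly_over k (coord_index (dims T)) F" "z \<in> hom_coords (dims S @ dims T) (fst e)" for F z
    by (rule poly_eval_shift[OF assms(1) that])
  show ?thesis
  proof (intro equalityI subsetI)
    fix R assume "R \<in> var_points k (var_prod k S T) e"
    then obtain z where z: "z \<in> hom_coords (dims S @ dims T) (fst e)"
      and R: "R = proj_point (dims S @ dims T) (fst e) z"
      and eq: "\<And>F. F \<in> equations (var_prod k S T) \<Longrightarrow> poly_eval k e F z = \<zero>\<^bsub>fst e\<^esub>"
      and ineq: "\<And>U. U \<in> inequations (var_prod k S T) \<Longrightarrow> \<exists>F\<in>U. poly_eval k e F z \<noteq> \<zero>\<^bsub>fst e\<^esub>"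
      by (rule var_pointsE) auto
    have "proj_point (dims S) (fst e) (?l z) \<in> var_points k S e"
    proof (rule var_pointsI[OF left_part_mem[OF z]])
      show "poly_eval k e F (?l z) = \<zero>\<^bsub>fst e\<^esub>" if "F \<in> equations S" for F
        using eq[of F] left[OF poly_varietyD(1)[OF assms(2) that] z] that by simp
      show "\<exists>F\<in>U. poly_eval k e F (?l z) \<noteq> \<zero>\<^bsub>fst e\<^esub>" if "U \<in> inequations S" for U
        using ineq[of U] left[OF poly_varietyD(2)[OF assms(2) that] z] that by auto
    qed
    moreover have "proj_point (dims T) (fst e) (?r z) \<in> var_points k T e"
    proof (rule var_pointsI[OF right_part_mem[OF z]])
      show "poly_eval k e F (?r z) = \<zero>\<^bsub>fst e\<^esub>" if "F \<in> equations T" for F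
        using eq[of "shift_poly k ?n F"] right[OF poly_varietyD(1)[OF assms(3) that] z] that by simp
      show "\<exists>F\<in>U. poly_eval k e F (?r z) \<noteq> \<zero>\<^bsub>fst e\<^esub>" if "U \<in> inequations T" for U
        using ineq[of "shift_poly k ?n ` U"] right[OF poly_varietyD(2)[OF assms(3) that] z] that by auto
    qed
    moreover have "R = pair_point S T (proj_point (dims S) (fst e) (?l z)) (proj_point (dims T) (fst e) (?r z))"
      using L.glue_proj_point[OF left_part_mem[OF z] right_part_mem[OF z]]
      by (simp add: R pair_point_glue glue_parts[OF z])
    ultimately show "R \<in> {pair_point S T P Q | P Q. P \<in> var_points k S e \<and> Q \<in> var_points k T e}"
      by blast
  next
    fix R assume "R \<in> {pair_point S T P Q | P Q. P \<in> var_points k S e \<and> Q \<in> var_points k T e}"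
    then obtain P Q where R: "R = pair_point S T P Q"
      and P: "P \<in> var_points k S e" and Q: "Q \<in> var_points k T e"
      by blast
    obtain x where x: "x \<in> hom_coords (dims S) (fst e)" and Px: "P = proj_point (dims S) (fst e) x"
      and eqx: "\<And>F. F \<in> equations S \<Longrightarrow> poly_eval k e F x = \<zero>\<^bsub>fst e\<^esub>"
      and ineqx: "\<And>U. U \<in> inequations S \<Longrightarrow> \<exists>F\<in>U. poly_eval k e F x \<noteq> \<zero>\<^bsub>fst e\<^esub>"
      using var_pointsE[OF P] by metis
    obtain y where y: "y \<in> hom_coords (dims T) (fst e)" and Qy: "Q = proj_point (dims T) (fst e) y"
      and eqy: "\<And>F. F \<in> equations T \<Longrightarrow> poly_eval k e F y = \<zero>\<^bsub>fst e\<^esub>"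
      and ineqy: "\<And>U. U \<in> inequations T \<Longrightarrow> \<exists>F\<in>U. poly_eval k e F y \<noteq> \<zero>\<^bsub>fst e\<^esub>"
      using var_pointsE[OF Q] by metis
    let ?z = "glue (dims S) (dims T) x y"
    have z: "?z \<in> hom_coords (dims S @ dims T) (fst e)"
      by (rule glue_mem[OF x y])
    note left' = left[OF _ z, unfolded left_part_glue[OF x]]
    note right' = right[OF _ z, unfolded right_part_glue[OF y]]
    have "proj_point (dims (var_prod k S T)) (fst e) ?z \<in> var_points k (var_prod k S T) e"
    proof (rule var_pointsI)
      show "?z \<in> hom_coords (dims (var_prod k S T)) (fst e)"
        using z by simp
      show "poly_eval k e F ?z = \<zero>\<^bsub>fst e\<^esub>" if "F \<in> equations (var_prod k S T)" for F
        using that left' right' eqx eqy poly_varietyD(1)[OF assms(2)] poly_varietyD(1)[OF assms(3)] by auto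
      fix U assume "U \<in> inequations (var_prod k S T)"
      then consider "U \<in> inequations S" | U' where "U' \<in> inequations T" "U = shift_poly k ?n ` U'"
        by auto
      then show "\<exists>F\<in>U. poly_eval k e F ?z \<noteq> \<zero>\<^bsub>fst e\<^esub>"
      proof cases
        case 1
        then show ?thesis
          using ineqx[OF 1] left'[OF poly_varietyD(2)[OF assms(2) 1]] by auto
      next
        case 2
        then show ?thesis
          using ineqy[OF 2(1)] right'[OF poly_varietyD(2)[OF assms(3) 2(1)]] by auto
      qed
    qed
    moreover have "R = proj_point (dims S @ dims T) (fst e) ?z"
      using L.glue_proj_point[OF x y] by (simp add: R pair_point_glue Px Qy)
    ultimately show "R \<in> var_points k (var_prod k S T) e"
      by simp
  qed
qed

section \<open>The multiplicative group\<close>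

definition torus_coords :: "'u ring \<Rightarrow> (nat \<times> nat \<Rightarrow> 'u) set" where
  "torus_coords L = {x \<in> hom_coords [1] L. x (0, 0) \<noteq> \<zero>\<^bsub>L\<^esub> \<and> x (0, 1) \<noteq> \<zero>\<^bsub>L\<^esub>}"

lemma coord_index_1: "(i, j) \<in> coord_index [Suc 0] \<longleftrightarrow> i = 0 \<and> (j = 0 \<or> j = 1)"
  by (auto simp: coord_index_iff)

lemma torus_coordsI:
  assumes "x (0, 0) \<in> carrier L - {\<zero>\<^bsub>L\<^esub>}" "x (0, 1) \<in> carrier L - {\<zero>\<^bsub>L\<^esub>}"
    and "\<And>u. u \<notin> coord_index [1] \<Longrightarrow> x u = undefined"
  shows "x \<in> torus_coords L"
proof -
  have "x \<in> hom_coords [1] L"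
    using assms by (intro hom_coordsI) (auto simp: coord_index_1)
  then show ?thesis
    using assms by (simp add: torus_coords_def)
qed

lemma torus_coords_nonzero:
  assumes "x \<in> torus_coords L" "(i, j) \<in> coord_index [1]"
  shows "x (i, j) \<in> carrier L - {\<zero>\<^bsub>L\<^esub>}"
  using assms hom_coords_closed[of x "[1]" L "(i, j)"] by (auto simp: torus_coords_def coord_index_1)

lemma torus_coords_hom_coords: "x \<in> torus_coords L \<Longrightarrow> x \<in> hom_coords [1] L"
  by (simp add: torus_coords_def)

lemma torus_coords_eqI:
  assumes "x \<in> torus_coords L" "y \<in> torus_coords L"
    and "\<And>i j. (i, j) \<in> coord_index [1] \<Longrightarrow> x (i, j) = y (i, j)"
  shows "x = y"
  by (rule hom_coords_eqI[OF assms(1,2)[THEN torus_coords_hom_coords] assms(3)])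

lemma poly_variety_Gm:
  assumes "field k"
  shows "poly_variety k (Gm_var k)"
proof -
  interpret field k by (rule assms)
  have "{m. (if m = {#(0, 0), (0, 1)#} then \<one>\<^bsub>k\<^esub> else \<zero>\<^bsub>k\<^esub>) \<noteq> \<zero>\<^bsub>k\<^esub>} = {{#(0::nat, 0::nat), (0, 1)#}}"
    by auto
  then have "poly_over k (coord_index [1]) (\<lambda>m. if m = {#(0, 0), (0, 1)#} then \<one>\<^bsub>k\<^esub> else \<zero>\<^bsub>k\<^esub>)"
    by (auto simp: poly_over_def coord_index_1)
  then show ?thesis
    by (simp add: poly_variety_def Gm_var_def)
qed

context extension_field
begin

lemma poly_eval_Gm:
  assumes "x \<in> hom_coords [1] L"
  shows "poly_eval k e (\<lambda>m. if m = {#(0, 0), (0, 1)#} then \<one>\<^bsub>k\<^esub> else \<zero>\<^bsub>k\<^esub>) x =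
    x (0, 0) \<otimes>\<^bsub>L\<^esub> x (0, 1)"
proof -
  have x: "x (0, 0) \<in> carrier L" "x (0, 1) \<in> carrier L"
    using hom_coords_closed[OF assms] by (simp_all add: coord_index_1)
  have "{m. (if m = {#(0, 0), (0, 1)#} then \<one>\<^bsub>k\<^esub> else \<zero>\<^bsub>k\<^esub>) \<noteq> \<zero>\<^bsub>k\<^esub>} = {{#(0::nat, 0::nat), (0, 1)#}}"
    by auto
  moreover have "snd e \<one>\<^bsub>k\<^esub> = \<one>\<^bsub>L\<^esub>"
    using field_extension ring_hom_one by (auto simp: field_extension_def)
  ultimately show ?thesis
    using x by (simp add: poly_eval_def)
qed

lemma var_points_Gm: "var_points k (Gm_var k) e = proj_point [1] L ` torus_coords L"
proof -
  let ?F = "\<lambda>m. if m = {#(0, 0), (0, 1)#} then \<one>\<^bsub>k\<^esub> else \<zero>\<^bsub>k\<^esub>"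
  have "poly_eval k e ?F x \<noteq> \<zero>\<^bsub>L\<^esub> \<longleftrightarrow> x (0, 0) \<noteq> \<zero>\<^bsub>L\<^esub> \<and> x (0, 1) \<noteq> \<zero>\<^bsub>L\<^esub>"
    if "x \<in> hom_coords [1] L" for x
    unfolding poly_eval_Gm[OF that] using hom_coords_closed[OF that]
    by (simp add: L.integral_iff coord_index_1)
  then have "{x \<in> hom_coords [1] L. poly_eval k e ?F x \<noteq> \<zero>\<^bsub>L\<^esub>} = torus_coords L"
    unfolding torus_coords_def by blast
  then show ?thesis
    by (simp add: var_points_def Gm_var_def)
qed

lemma carrier_Gm: "carrier (grp (Gm k) e) = proj_point [1] L ` torus_coords L"
  by (simp add: Gm_def var_points_Gm)

lemma torus_coords_mult:
  assumes "x \<in> torus_coords L" "y \<in> torus_coords L"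
  shows "(\<lambda>u\<in>coord_index [1]. x u \<otimes>\<^bsub>L\<^esub> y u) \<in> torus_coords L"
  using L.mult_nonzero[OF torus_coords_nonzero[OF assms(1)] torus_coords_nonzero[OF assms(2)]]
  by (intro torus_coordsI) (simp_all add: coord_index_1)

text \<open>The product in \<open>Gm\<close> is formed over all representatives of both points. In
  one direction the scalars are multiplied; in the other, the scalar of a vector in the product
  class is moved entirely to the first factor.\<close>

lemma Gm_mult_proj_point:
  assumes "x \<in> torus_coords L" "y \<in> torus_coords L"
  shows "proj_point [1] L x \<otimes>\<^bsub>grp (Gm k) e\<^esub> proj_point [1] L y =
    proj_point [1] L (\<lambda>u\<in>coord_index [1]. x u \<otimes>\<^bsub>L\<^esub> y u)" (is "_ = proj_point _ _ ?xy")
proof -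
  have "{\<lambda>u\<in>coord_index [1]. x' u \<otimes>\<^bsub>L\<^esub> y' u | x' y'. x' \<in> proj_point [1] L x \<and> y' \<in> proj_point [1] L y} =
      proj_point [1] L ?xy" (is "?A = _")
  proof (intro equalityI subsetI)
    fix z assume "z \<in> ?A"
    then obtain x' y' where xp: "x' \<in> proj_point [1] L x" and yp: "y' \<in> proj_point [1] L y"
      and z: "z = (\<lambda>u\<in>coord_index [1]. x' u \<otimes>\<^bsub>L\<^esub> y' u)"
      by blast
    obtain c where x': "x' \<in> hom_coords [1] L"
      and c: "\<And>i. i < length [1::nat] \<Longrightarrow> c i \<in> carrier L - {\<zero>\<^bsub>L\<^esub>}"
      and xc: "\<And>i j. (i, j) \<in> coord_index [1] \<Longrightarrow> x' (i, j) = c i \<otimes>\<^bsub>L\<^esub> x (i, j)"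
      by (rule proj_pointE[OF xp]) (rule that; blast)
    obtain d where y': "y' \<in> hom_coords [1] L"
      and d: "\<And>i. i < length [1::nat] \<Longrightarrow> d i \<in> carrier L - {\<zero>\<^bsub>L\<^esub>}"
      and yd: "\<And>i j. (i, j) \<in> coord_index [1] \<Longrightarrow> y' (i, j) = d i \<otimes>\<^bsub>L\<^esub> y (i, j)"
      by (rule proj_pointE[OF yp]) (rule that; blast)
    have zcd: "z (i, j) = (c i \<otimes>\<^bsub>L\<^esub> d i) \<otimes>\<^bsub>L\<^esub> ?xy (i, j)" if "(i, j) \<in> coord_index [1]" for i j
    proof -
      have "c i \<in> carrier L" "d i \<in> carrier L" "x (i, j) \<in> carrier L" "y (i, j) \<in> carrier L"
        using that c[of i] d[of i]
          torus_coords_nonzero[OF assms(1) that] torus_coords_nonzero[OF assms(2) that]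
        by (simp_all add: coord_index_1)
      then show ?thesis
        using that by (simp add: z xc yd L.m_ac)
    qed
    have cd: "c i \<otimes>\<^bsub>L\<^esub> d i \<in> carrier L - {\<zero>\<^bsub>L\<^esub>}" if "i < length [1::nat]" for i
      by (rule L.mult_nonzero[OF c[OF that] d[OF that]])
    have "z (i, j) \<in> carrier L - {\<zero>\<^bsub>L\<^esub>}" if "(i, j) \<in> coord_index [1]" for i j
      unfolding zcd[OF that]
      using that by (intro L.mult_nonzero cd torus_coords_nonzero[OF torus_coords_mult[OF assms]])
        (simp_all add: coord_index_1)
    moreover have "z u = undefined" if "u \<notin> coord_index [1]" for u
      using that by (simp add: z)
    ultimately have "z \<in> torus_coords L"
      by (intro torus_coordsI) (simp_all add: coord_index_1)
    show "z \<in> proj_point [1] L ?xy"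
    proof (rule proj_pointI)
      show "z \<in> hom_coords [1] L"
        by (rule torus_coords_hom_coords) fact
      show "c i \<otimes>\<^bsub>L\<^esub> d i \<in> carrier L - {\<zero>\<^bsub>L\<^esub>}" if "i < length [1::nat]" for i
        using that by (rule cd)
      show "z (i, j) = (c i \<otimes>\<^bsub>L\<^esub> d i) \<otimes>\<^bsub>L\<^esub> ?xy (i, j)" if "(i, j) \<in> coord_index [1]" for i j
        using that by (rule zcd)
    qed
  next
    fix z assume zp: "z \<in> proj_point [1] L ?xy"
    obtain c where z: "z \<in> hom_coords [1] L"
      and c: "\<And>i. i < length [1::nat] \<Longrightarrow> c i \<in> carrier L - {\<zero>\<^bsub>L\<^esub>}"
      and zc: "\<And>i j. (i, j) \<in> coord_index [1] \<Longrightarrow> z (i, j) = c i \<otimes>\<^bsub>L\<^esub> ?xy (i, j)"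
      by (rule proj_pointE[OF zp]) (rule that; blast)
    define x' where "x' = (\<lambda>(i, j)\<in>coord_index [1]. c i \<otimes>\<^bsub>L\<^esub> x (i, j))"
    have "x' \<in> hom_coords [1] L"
      unfolding x'_def using torus_coords_hom_coords[OF assms(1)] c by (rule L.scale_mem)
    then have "x' \<in> proj_point [1] L x"
      using c by (intro proj_pointI[of _ _ _ c]) (simp_all add: x'_def)
    moreover have "y \<in> proj_point [1] L y"
      by (rule L.self_mem_proj_point[OF torus_coords_hom_coords[OF assms(2)]])
    moreover have "z = (\<lambda>u\<in>coord_index [1]. x' u \<otimes>\<^bsub>L\<^esub> y u)"
    proof
      fix u show "z u = (\<lambda>u\<in>coord_index [1]. x' u \<otimes>\<^bsub>L\<^esub> y u) u"
      proof (cases "u \<in> coord_index [1]")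
        case True
        obtain i j where u: "u = (i, j)" by (cases u)
        with True have ij: "(i, j) \<in> coord_index [1]" by simp
        show ?thesis
          using c[of i] torus_coords_nonzero[OF assms(1) ij] torus_coords_nonzero[OF assms(2) ij] ij
          by (simp add: u zc x'_def L.m_assoc coord_index_1)
      next
        case False
        then show ?thesis
          using hom_coords_extensional[OF z] by simp
      qed
    qed
    ultimately show "z \<in> ?A"
      by (intro CollectI exI[of _ x'] exI[of _ y] conjI)
  qed
  then show ?thesis
    by (simp add: Gm_def)
qed

lemma torus_one: "coord_vec [\<one>\<^bsub>L\<^esub>, \<one>\<^bsub>L\<^esub>] \<in> torus_coords L"
  by (rule torus_coordsI) (auto simp: coord_vec_def coord_index_1)

text \<open>By \<open>Gm_mult_proj_point\<close> products can be computed on chosen representatives,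
  so every law reduces to the same law for pairs of nonzero elements of \<open>L\<close> under
  coordinatewise multiplication.\<close>

lemma comm_group_Gm: "comm_group (grp (Gm k) e)" (is "comm_group ?G")
proof (rule comm_groupI)
  have one: "\<one>\<^bsub>?G\<^esub> = proj_point [1] L (coord_vec [\<one>\<^bsub>L\<^esub>, \<one>\<^bsub>L\<^esub>])"
    by (simp add: Gm_def)
  show "\<one>\<^bsub>?G\<^esub> \<in> carrier ?G"
    unfolding one carrier_Gm using torus_one by (rule imageI)
  note cl = torus_coords_nonzero[THEN DiffD1]
  fix P assume "P \<in> carrier ?G"
  then obtain x where x: "x \<in> torus_coords L" "P = proj_point [1] L x"
    by (auto simp: carrier_Gm)
  have "(\<lambda>u\<in>coord_index [1]. coord_vec [\<one>\<^bsub>L\<^esub>, \<one>\<^bsub>L\<^esub>] u \<otimes>\<^bsub>L\<^esub> x u) = x"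
    using cl[OF x(1)]
    by (intro torus_coords_eqI[of _ L] torus_coords_mult torus_one x(1))
      (auto simp: coord_vec_def coord_index_1)
  then show "\<one>\<^bsub>?G\<^esub> \<otimes>\<^bsub>?G\<^esub> P = P"
    by (simp add: one x(2) Gm_mult_proj_point[OF torus_one x(1), simplified])
  define x' where "x' = (\<lambda>u\<in>coord_index [1]. inv\<^bsub>L\<^esub> x u)"
  have x': "x' \<in> torus_coords L"
    using L.inv_nonzero(1)[OF torus_coords_nonzero[OF x(1)]]
    by (intro torus_coordsI) (simp_all add: x'_def coord_index_1)
  have "(\<lambda>u\<in>coord_index [1]. x' u \<otimes>\<^bsub>L\<^esub> x u) = coord_vec [\<one>\<^bsub>L\<^esub>, \<one>\<^bsub>L\<^esub>]"
    using L.inv_nonzero(2)[OF torus_coords_nonzero[OF x(1)]]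
    by (intro torus_coords_eqI[of _ L] torus_coords_mult torus_one x(1) x')
      (auto simp: coord_vec_def coord_index_1 x'_def)
  then have "proj_point [1] L x' \<otimes>\<^bsub>?G\<^esub> P = \<one>\<^bsub>?G\<^esub>"
    by (simp add: one x(2) Gm_mult_proj_point[OF x' x(1), simplified])
  then show "\<exists>Q\<in>carrier ?G. Q \<otimes>\<^bsub>?G\<^esub> P = \<one>\<^bsub>?G\<^esub>"
    using x' by (auto simp: carrier_Gm)
  fix Q assume "Q \<in> carrier ?G"
  then obtain y where y: "y \<in> torus_coords L" "Q = proj_point [1] L y"
    by (auto simp: carrier_Gm)
  show "P \<otimes>\<^bsub>?G\<^esub> Q \<in> carrier ?G"
    unfolding x(2) y(2) Gm_mult_proj_point[OF x(1) y(1)] carrier_Gm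
    by (intro imageI torus_coords_mult x(1) y(1))
  have "(\<lambda>u\<in>coord_index [1]. x u \<otimes>\<^bsub>L\<^esub> y u) = (\<lambda>u\<in>coord_index [1]. y u \<otimes>\<^bsub>L\<^esub> x u)"
    using cl[OF x(1)] cl[OF y(1)]
    by (intro torus_coords_eqI[of _ L] torus_coords_mult x(1) y(1))
      (simp add: L.m_comm)
  then show "P \<otimes>\<^bsub>?G\<^esub> Q = Q \<otimes>\<^bsub>?G\<^esub> P"
    unfolding x(2) y(2) Gm_mult_proj_point[OF x(1) y(1)] Gm_mult_proj_point[OF y(1) x(1)] by simp
  fix R assume "R \<in> carrier ?G"
  then obtain z where z: "z \<in> torus_coords L" "R = proj_point [1] L z"
    by (auto simp: carrier_Gm)
  have "(\<lambda>u\<in>coord_index [1]. (\<lambda>u\<in>coord_index [1]. x u \<otimes>\<^bsub>L\<^esub> y u) u \<otimes>\<^bsub>L\<^esub> z u) =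
      (\<lambda>u\<in>coord_index [1]. x u \<otimes>\<^bsub>L\<^esub> (\<lambda>u\<in>coord_index [1]. y u \<otimes>\<^bsub>L\<^esub> z u) u)"
    using cl[OF x(1)] cl[OF y(1)] cl[OF z(1)]
    by (intro torus_coords_eqI[of _ L] torus_coords_mult x(1) y(1) z(1))
      (simp add: L.m_assoc)
  then show "P \<otimes>\<^bsub>?G\<^esub> Q \<otimes>\<^bsub>?G\<^esub> R = P \<otimes>\<^bsub>?G\<^esub> (Q \<otimes>\<^bsub>?G\<^esub> R)"
    unfolding x(2) y(2) z(2) Gm_mult_proj_point[OF x(1) y(1)] Gm_mult_proj_point[OF y(1) z(1)]
      Gm_mult_proj_point[OF torus_coords_mult[OF x(1) y(1)] z(1)]
      Gm_mult_proj_point[OF x(1) torus_coords_mult[OF y(1) z(1)]] by simp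
qed

end

section \<open>Elliptic curves\<close>

lemma coord_index_2: "(i, j) \<in> coord_index [2] \<longleftrightarrow> i = 0 \<and> (j = 0 \<or> j = 1 \<or> j = 2)"
  by (auto simp: coord_index_iff)

text \<open>The cube of Y is the only cubic monomial free of X and Z, and it does not occur.
  Together with \<open>poly_eval_eq_zero\<close> the second claim puts [0 : 1 : 0] on the
  curve.\<close>

lemma weierstrass_poly_over:
  assumes "field k" "elliptic_curve k W"
  shows "poly_over k (coord_index [2]) (weierstrass_poly k W)"
    and "weierstrass_poly k W m \<noteq> \<zero>\<^bsub>k\<^esub> \<Longrightarrow> (0, 0) \<in># m \<or> (0, 2) \<in># m"
proof -
  interpret field k by (rule assms(1))
  let ?F = "weierstrass_poly k W"
  let ?X = "(0::nat, 0::nat)" and ?Y = "(0::nat, 1::nat)" and ?Z = "(0::nat, 2::nat)"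
  have supp: "{m. ?F m \<noteq> \<zero>\<^bsub>k\<^esub>} \<subseteq> {{#?Y, ?Y, ?Z#}, {#?X, ?Y, ?Z#}, {#?Y, ?Z, ?Z#},
      {#?X, ?X, ?X#}, {#?X, ?X, ?Z#}, {#?X, ?Z, ?Z#}, {#?Z, ?Z, ?Z#}}"
    unfolding weierstrass_poly_def Let_def by (auto split: if_splits)
  then have "finite {m. ?F m \<noteq> \<zero>\<^bsub>k\<^esub>}"
    by (rule finite_subset) simp
  moreover have "?F m \<in> carrier k" for m
    using assms(2) unfolding weierstrass_poly_def Let_def elliptic_curve_def by simp
  moreover have "set_mset m \<subseteq> coord_index [2]" if "?F m \<noteq> \<zero>\<^bsub>k\<^esub>" for m
    using subsetD[OF supp, of m] that by (auto simp: coord_index_2)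
  ultimately show "poly_over k (coord_index [2]) ?F"
    by (simp add: poly_over_def)
  show "?F m \<noteq> \<zero>\<^bsub>k\<^esub> \<Longrightarrow> (0, 0) \<in># m \<or> (0, 2) \<in># m"
    using subsetD[OF supp, of m] by auto
qed

lemma poly_variety_elliptic:
  assumes "field k" "elliptic_curve k W"
  shows "poly_variety k (elliptic_var k W)"
  using weierstrass_poly_over(1)[OF assms] by (simp add: poly_variety_def elliptic_var_def)

lemma (in plain_field) infinity_hom_coords: "coord_vec [\<zero>, \<one>, \<zero>] \<in> hom_coords [2] R"
proof (rule hom_coordsI)
  fix i assume "i < length [2::nat]"
  then show "\<exists>j\<le>[2] ! i. coord_vec [\<zero>, \<one>, \<zero>] (i, j) \<noteq> \<zero>"
    by (intro exI[of _ 1]) (simp add: coord_vec_def)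
qed (auto simp: coord_vec_def coord_index_2)

lemma (in extension_field) infinity_point_var_points:
  assumes "elliptic_curve k W"
  shows "infinity_point L \<in> var_points k (elliptic_var k W) e"
proof -
  let ?x = "coord_vec [\<zero>\<^bsub>L\<^esub>, \<one>\<^bsub>L\<^esub>, \<zero>\<^bsub>L\<^esub>]"
  have "poly_eval k e (weierstrass_poly k W) ?x = \<zero>\<^bsub>L\<^esub>"
  proof (rule poly_eval_eq_zero[OF field_extension weierstrass_poly_over(1)[OF k.field_axioms assms]])
    show "?x u \<in> carrier L" if "u \<in> coord_index [2]" for u
      by (rule hom_coords_closed[OF L.infinity_hom_coords that])
    have "?x (0, 0) = \<zero>\<^bsub>L\<^esub>" "?x (0, 2) = \<zero>\<^bsub>L\<^esub>"
      by (simp_all add: coord_vec_def)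
    then show "\<exists>u\<in>#m. ?x u = \<zero>\<^bsub>L\<^esub>" if "weierstrass_poly k W m \<noteq> \<zero>\<^bsub>k\<^esub>" for m
      using weierstrass_poly_over(2)[OF k.field_axioms assms that] by blast
  qed
  then have "proj_point (dims (elliptic_var k W)) L ?x \<in> var_points k (elliptic_var k W) e"
    using L.infinity_hom_coords by (intro var_pointsI) (simp_all add: elliptic_var_def)
  then show ?thesis
    by (simp add: infinity_point_def elliptic_var_def)
qed

lemma elliptic_add_infinity:
  "elliptic_add W e (infinity_point (fst e)) P = P"
  "elliptic_add W e P (infinity_point (fst e)) = P"
  by (auto simp: elliptic_add_def Let_def)

text \<open>Every value of \<open>elliptic_add\<close> is one of the arguments or a class formed by
  \<open>proj_point\<close>, hence a set of coordinate vectors, whether or not the computed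
  coordinates satisfy the equation. This weak form is enough to recover a sum from a pair.\<close>

lemma elliptic_add_subset:
  assumes "P \<subseteq> hom_coords [2] (fst e)" "Q \<subseteq> hom_coords [2] (fst e)"
  shows "elliptic_add W e P Q \<subseteq> hom_coords [2] (fst e)"
proof -
  have "infinity_point (fst e) \<subseteq> hom_coords [2] (fst e)"
    and "affine_point (fst e) x y \<subseteq> hom_coords [2] (fst e)" for x y
    by (simp_all add: infinity_point_def affine_point_def proj_point_subset)
  then show ?thesis
    using assms unfolding elliptic_add_def Let_def by (simp split: prod.split)
qed

section \<open>Commutative semidirect products\<close>

text \<open>These hold in any structure by the recursive definition of powers. They are applied to
  the points of the curve, where no monoid law has been established.\<close>

lemma nat_pow_0_unfold: "x [^]\<^bsub>G\<^esub> (0::nat) = \<one>\<^bsub>G\<^esub>"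
  and nat_pow_Suc_unfold: "x [^]\<^bsub>G\<^esub> Suc n = x [^]\<^bsub>G\<^esub> n \<otimes>\<^bsub>G\<^esub> x"
  by (simp_all add: nat_pow_def)

lemma gvar_simps [simp]:
  "gvar (Gm k) = Gm_var k" "gvar (elliptic_group k W) = elliptic_var k W"
  "gvar (semidirect_product k N H \<phi>) = var_prod k (gvar N) (gvar H)"
  "dims (Gm_var k) = [1]" "dims (elliptic_var k W) = [2]"
  by (simp_all add: Gm_def elliptic_group_def semidirect_product_def Gm_var_def elliptic_var_def Let_def)

lemma elliptic_group_simps [simp]:
  "carrier (grp (elliptic_group k W) e) = var_points k (elliptic_var k W) e"
  "P \<otimes>\<^bsub>grp (elliptic_group k W) e\<^esub> Q = elliptic_add W e P Q"
  "\<one>\<^bsub>grp (elliptic_group k W) e\<^esub> = infinity_point (fst e)"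
  by (simp_all add: elliptic_group_def)

lemma carrier_Gm_var_points: "carrier (grp (Gm k) e) = var_points k (Gm_var k) e"
  by (simp add: Gm_def)

lemma semidirect_product_simps:
  "carrier (grp (semidirect_product k N H \<phi>) e) = var_points k (var_prod k (gvar N) (gvar H)) e"
  "R \<otimes>\<^bsub>grp (semidirect_product k N H \<phi>) e\<^esub> R' = pair_point (gvar N) (gvar H)
     (fst_point (gvar N) (gvar H) R \<otimes>\<^bsub>grp N e\<^esub>
        \<phi> e (snd_point (gvar N) (gvar H) R) (fst_point (gvar N) (gvar H) R'))
     (snd_point (gvar N) (gvar H) R \<otimes>\<^bsub>grp H e\<^esub> snd_point (gvar N) (gvar H) R')"
  "\<one>\<^bsub>grp (semidirect_product k N H \<phi>) e\<^esub> = pair_point (gvar N) (gvar H) \<one>\<^bsub>grp N e\<^esub> \<one>\<^bsub>grp H e\<^esub>"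
  by (simp_all add: semidirect_product_def Let_def)

text \<open>The situation over one extension \<open>e\<close>. The laws of a commutative group are
  assumed for \<open>G\<close>; of the semidirect product it is assumed that \<open>f\<close> is a
  multiplicative bijection from \<open>G\<close> onto it.\<close>

locale commutative_semidirect = extension_field k e for k :: "'a ring" and e :: "'a extension" +
  fixes W :: "'a weierstrass"
    and \<phi> :: "'a extension \<Rightarrow> 'a point \<Rightarrow> 'a point \<Rightarrow> 'a point"
    and G :: "'a point monoid" and f :: "'a point \<Rightarrow> 'a point"
  assumes elliptic: "elliptic_curve k W"
    and phi: "\<phi> e \<in> hom (grp (elliptic_group k W) e) (Aut_Gm k e)"
    and comm_group_G: "comm_group G"
    and iso: "f \<in> iso G (grp (semidirect_product k (Gm k) (elliptic_group k W) \<phi>) e)"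
begin

abbreviation "N \<equiv> grp (Gm k) e"
abbreviation "H \<equiv> grp (elliptic_group k W) e"
abbreviation "M \<equiv> grp (semidirect_product k (Gm k) (elliptic_group k W) \<phi>) e"
abbreviation "pair \<equiv> pair_point (Gm_var k) (elliptic_var k W)"
abbreviation "p1 \<equiv> fst_point (Gm_var k) (elliptic_var k W)"
abbreviation "p2 \<equiv> snd_point (Gm_var k) (elliptic_var k W)"

sublocale N: comm_group N by (rule comm_group_Gm)

lemma point_properties:
  "g \<in> carrier N \<Longrightarrow> g \<subseteq> hom_coords [1] L" "g \<in> carrier N \<Longrightarrow> g \<noteq> {}"
  "P \<in> carrier H \<Longrightarrow> P \<subseteq> hom_coords [2] L" "P \<in> carrier H \<Longrightarrow> P \<noteq> {}"
  using var_points_subset[of g k "Gm_var k" e] var_points_nonempty[OF field_L, of g k "Gm_var k"]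
    var_points_subset[of P k "elliptic_var k W" e] var_points_nonempty[OF field_L, of P k "elliptic_var k W"]
  by (simp_all add: carrier_Gm_var_points)

lemma projections:
  assumes "g \<in> carrier N" "P \<in> carrier H"
  shows "p1 (pair g P) = g" "p2 (pair g P) = P"
  using fst_point_pair[of g "Gm_var k" L P] snd_point_pair[of P "elliptic_var k W" L g]
    point_properties(1,2)[OF assms(1)] point_properties(3,4)[OF assms(2)] by simp_all

lemma carrier_M: "carrier M = {pair g P | g P. g \<in> carrier N \<and> P \<in> carrier H}"
  using var_points_prod[OF field_extension poly_variety_Gm[OF k.field_axioms]
      poly_variety_elliptic[OF k.field_axioms elliptic]]
  by (simp add: semidirect_product_simps carrier_Gm_var_points)

lemma infinity_mem: "infinity_point L \<in> carrier H"
  using infinity_point_var_points[OF elliptic] by simp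

lemma phi_cases:
  assumes "P \<in> carrier H"
  obtains "\<And>g. g \<in> carrier N \<Longrightarrow> \<phi> e P g = g" | "\<And>g. g \<in> carrier N \<Longrightarrow> \<phi> e P g = inv\<^bsub>N\<^esub> g"
proof -
  have "\<phi> e P \<in> carrier (Aut_Gm k e)"
    using phi assms by (auto simp: hom_def)
  then consider "\<phi> e P = (\<lambda>g\<in>carrier N. g)" | "\<phi> e P = (\<lambda>g\<in>carrier N. inv\<^bsub>N\<^esub> g)"
    by (auto simp: Aut_Gm_def)
  then show ?thesis
    by cases (use that in auto)
qed

lemma phi_one: "P \<in> carrier H \<Longrightarrow> \<phi> e P \<one>\<^bsub>N\<^esub> = \<one>\<^bsub>N\<^esub>"
  by (erule phi_cases) simp_all

lemma phi_closed: "P \<in> carrier H \<Longrightarrow> g \<in> carrier N \<Longrightarrow> \<phi> e P g \<in> carrier N"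
  by (erule phi_cases) simp_all

lemma mult_M_phi:
  assumes "g \<in> carrier N" "P \<in> carrier H" "g' \<in> carrier N" "P' \<in> carrier H"
  shows "pair g P \<otimes>\<^bsub>M\<^esub> pair g' P' = pair (g \<otimes>\<^bsub>N\<^esub> \<phi> e P g') (P \<otimes>\<^bsub>H\<^esub> P')"
  using projections[OF assms(1,2)] projections[OF assms(3,4)] by (simp add: semidirect_product_simps)

lemma pair_mem: "g \<in> carrier N \<Longrightarrow> P \<in> carrier H \<Longrightarrow> pair g P \<in> carrier M"
  unfolding carrier_M by blast

text \<open>The laws of \<open>G\<close> are transported along \<open>f\<close>. This makes the
  image of the neutral element of \<open>G\<close> the neutral element; that it is the declared one
  is shown in \<open>one_M\<close>.\<close>

lemma comm_group_M': "comm_group (M\<lparr>one := f \<one>\<^bsub>G\<^esub>\<rparr>)"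
  using comm_group.iso_imp_img_comm_group[OF comm_group_G iso] .

lemma mult_M_comm: "R \<in> carrier M \<Longrightarrow> R' \<in> carrier M \<Longrightarrow> R \<otimes>\<^bsub>M\<^esub> R' = R' \<otimes>\<^bsub>M\<^esub> R"
  using comm_monoid.m_comm[OF comm_group.axioms(1)[OF comm_group_M']] by simp

lemma mult_M_closed: "R \<in> carrier M \<Longrightarrow> R' \<in> carrier M \<Longrightarrow> R \<otimes>\<^bsub>M\<^esub> R' \<in> carrier M"
  using monoid.m_closed[OF comm_monoid.axioms(1)[OF comm_group.axioms(1)[OF comm_group_M']]] by simp

text \<open>\<open>(g, 0)\<close> and \<open>(1, P)\<close> commute, and their products in the two orders are \<open>(g, P)\<close> and
  \<open>(\<phi>(P)(g), P)\<close>.\<close>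

lemma phi_trivial:
  assumes "g \<in> carrier N" "P \<in> carrier H"
  shows "\<phi> e P g = g"
proof -
  have "pair g P = pair (g \<otimes>\<^bsub>N\<^esub> \<phi> e (infinity_point L) \<one>\<^bsub>N\<^esub>) (infinity_point L \<otimes>\<^bsub>H\<^esub> P)"
    by (simp only: phi_one[OF infinity_mem] N.r_one[OF assms(1)] elliptic_group_simps(2)
      elliptic_add_infinity)
  also have "\<dots> = pair g (infinity_point L) \<otimes>\<^bsub>M\<^esub> pair \<one>\<^bsub>N\<^esub> P"
    by (rule mult_M_phi[OF assms(1) infinity_mem N.one_closed assms(2), symmetric])
  also have "\<dots> = pair \<one>\<^bsub>N\<^esub> P \<otimes>\<^bsub>M\<^esub> pair g (infinity_point L)"
    by (rule mult_M_comm[OF pair_mem[OF assms(1) infinity_mem] pair_mem[OF N.one_closed assms(2)]])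
  also have "\<dots> = pair (\<one>\<^bsub>N\<^esub> \<otimes>\<^bsub>N\<^esub> \<phi> e P g) (P \<otimes>\<^bsub>H\<^esub> infinity_point L)"
    by (rule mult_M_phi[OF N.one_closed assms(2,1) infinity_mem])
  also have "\<dots> = pair (\<phi> e P g) P"
    by (simp only: N.l_one[OF phi_closed[OF assms(2,1)]] elliptic_group_simps(2) elliptic_add_infinity)
  finally have "p1 (pair g P) = p1 (pair (\<phi> e P g) P)"
    by (rule arg_cong)
  then show ?thesis
    unfolding projections(1)[OF assms] projections(1)[OF phi_closed[OF assms(2,1)] assms(2)] by (rule sym)
qed

lemma mult_M:
  assumes "g \<in> carrier N" "P \<in> carrier H" "g' \<in> carrier N" "P' \<in> carrier H"
  shows "pair g P \<otimes>\<^bsub>M\<^esub> pair g' P' = pair (g \<otimes>\<^bsub>N\<^esub> g') (P \<otimes>\<^bsub>H\<^esub> P')"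
  unfolding mult_M_phi[OF assms] phi_trivial[OF assms(3,2)] ..

text \<open>Closure without any computation on the curve: the product of (1, P) and (1, P') lies in
  the semidirect product, whose points are pairs of points, and its second component is P +
  P'.\<close>

lemma mult_H_closed:
  assumes "P \<in> carrier H" "P' \<in> carrier H"
  shows "P \<otimes>\<^bsub>H\<^esub> P' \<in> carrier H"
proof -
  have "pair (\<one>\<^bsub>N\<^esub> \<otimes>\<^bsub>N\<^esub> \<one>\<^bsub>N\<^esub>) (P \<otimes>\<^bsub>H\<^esub> P') \<in> carrier M"
    unfolding mult_M[OF N.one_closed assms(1) N.one_closed assms(2), symmetric]
    by (intro mult_M_closed pair_mem N.one_closed assms)
  then obtain g Q where gQ: "g \<in> carrier N" "Q \<in> carrier H"
    and eq: "pair \<one>\<^bsub>N\<^esub> (P \<otimes>\<^bsub>H\<^esub> P') = pair g Q"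
    unfolding carrier_M by auto
  \<comment> \<open>The sum is not yet known to be a point, so \<open>projections\<close> does not
    apply to the pair formed with it; \<open>snd_point_pair\<close> asks only for a set of
    coordinate vectors.\<close>
  have "P \<otimes>\<^bsub>H\<^esub> P' \<subseteq> hom_coords (dims (elliptic_var k W)) L"
    using elliptic_add_subset[OF point_properties(3)[OF assms(1)] point_properties(3)[OF assms(2)]] by simp
  then have "P \<otimes>\<^bsub>H\<^esub> P' = p2 (pair \<one>\<^bsub>N\<^esub> (P \<otimes>\<^bsub>H\<^esub> P'))"
    using snd_point_pair[OF _ point_properties(2)[OF N.one_closed]] by simp
  then show ?thesis
    using gQ by (simp only: eq projections(2))
qed

text \<open>The pair of neutral elements is a left identity for the explicit law, and the image of
  the neutral element of \<open>G\<close> is a right identity by transport. The product of the two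
  is equal to both.\<close>

lemma one_M: "f \<one>\<^bsub>G\<^esub> = \<one>\<^bsub>M\<^esub>"
proof -
  interpret M': comm_group "M\<lparr>one := f \<one>\<^bsub>G\<^esub>\<rparr>" by (rule comm_group_M')
  have one: "\<one>\<^bsub>M\<^esub> = pair \<one>\<^bsub>N\<^esub> (infinity_point L)"
    by (simp add: semidirect_product_simps)
  have l_one: "\<one>\<^bsub>M\<^esub> \<otimes>\<^bsub>M\<^esub> R = R" if R: "R \<in> carrier M" for R
  proof -
    obtain g P where gP: "R = pair g P" "g \<in> carrier N" "P \<in> carrier H"
      using R unfolding carrier_M by blast
    show ?thesis
      unfolding one gP(1) mult_M[OF N.one_closed infinity_mem gP(2,3)]
      by (simp only: N.l_one[OF gP(2)] elliptic_group_simps(2) elliptic_add_infinity)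
  qed
  have "\<one>\<^bsub>M\<^esub> \<in> carrier M"
    unfolding one by (rule pair_mem[OF N.one_closed infinity_mem])
  then have "\<one>\<^bsub>M\<^esub> \<otimes>\<^bsub>M\<^esub> f \<one>\<^bsub>G\<^esub> = \<one>\<^bsub>M\<^esub>"
    using M'.r_one by simp
  moreover have "f \<one>\<^bsub>G\<^esub> \<in> carrier M"
    using M'.one_closed by simp
  ultimately show ?thesis
    using l_one by metis
qed

lemma comm_group_M: "comm_group M"
  using comm_group_M' by (simp add: one_M)

lemma pow_closed:
  assumes "P \<in> carrier H"
  shows "P [^]\<^bsub>H\<^esub> (n::nat) \<in> carrier H"
proof (induction n)
  case 0
  show ?case
    using infinity_mem by (simp add: nat_pow_0_unfold)
next
  case (Suc n)
  show ?case
    unfolding nat_pow_Suc_unfold by (rule mult_H_closed[OF Suc assms])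
qed

lemma pow_infinity: "infinity_point L [^]\<^bsub>H\<^esub> (n::nat) = infinity_point L"
  by (induction n) (simp_all add: nat_pow_0_unfold nat_pow_Suc_unfold elliptic_add_infinity)

lemma pow_pair:
  assumes "g \<in> carrier N" "P \<in> carrier H"
  shows "pair g P [^]\<^bsub>M\<^esub> (n::nat) = pair (g [^]\<^bsub>N\<^esub> n) (P [^]\<^bsub>H\<^esub> n)"
proof (induction n)
  case 0
  then show ?case
    by (simp add: nat_pow_0_unfold semidirect_product_simps)
next
  case (Suc n)
  show ?case
    unfolding nat_pow_Suc_unfold Suc
    by (rule mult_M[OF N.nat_pow_closed[OF assms(1)] pow_closed[OF assms(2)] assms])
qed

end

section \<open>Local-global divisibility\<close>

text \<open>\<open>f\<close> maps a local divisor of \<open>P\<close> to one of the image of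
  \<open>P\<close>, so the image fails to be divisible at most at the places where \<open>P\<close>
  fails. A global divisor of the image is brought back by \<open>g\<close>. The two groups are
  arbitrary so that the two directions of an isomorphism can exchange roles.\<close>

lemma local_global_divisibility_transfer:
  assumes "field k"
    and groups: "\<And>e. field_extension k e \<Longrightarrow> group (grp G e)" "\<And>e. field_extension k e \<Longrightarrow> group (grp H e)"
    and f: "\<And>e. field_extension k e \<Longrightarrow> f e \<in> hom (grp G e) (grp H e)"
    and g: "g \<in> hom (grp H (base_extension k)) (grp G (base_extension k))"
    and gf: "\<And>P. P \<in> carrier (grp G (base_extension k)) \<Longrightarrow> g (f (base_extension k) P) = P"
    and bc: "\<And>e P. field_extension k e \<Longrightarrow> P \<in> carrier (grp G (base_extension k)) \<Longrightarrow>
        f e (base_change k (gvar G) e P) = base_change k (gvar H) e (f (base_extension k) P)"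
    and H: "local_global_divisibility k H q"
  shows "local_global_divisibility k G q"
  unfolding local_global_divisibility_def
proof (intro ballI impI)
  let ?b = "base_extension k" and ?c = "completion_extension k"
  note fb = field_extension_base[OF assms(1)]
  fix P assume P: "P \<in> carrier (grp G ?b)"
  assume fin: "finite {V \<in> places k. \<not> (\<exists>D\<in>carrier (grp G (?c V)).
    base_change k (gvar G) (?c V) P = D [^]\<^bsub>grp G (?c V)\<^esub> q)}" (is "finite ?A")
  have fP: "f ?b P \<in> carrier (grp H ?b)"
    using f[OF fb] P by (rule hom_in_carrier)
  have "\<exists>D\<in>carrier (grp H (?c V)). base_change k (gvar H) (?c V) (f ?b P) = D [^]\<^bsub>grp H (?c V)\<^esub> q"
    if V: "V \<in> places k" and div: "\<exists>D\<in>carrier (grp G (?c V)).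
      base_change k (gvar G) (?c V) P = D [^]\<^bsub>grp G (?c V)\<^esub> q" for V
  proof -
    note fc = field_extension_completion[OF assms(1) V]
    obtain D where D: "D \<in> carrier (grp G (?c V))"
      and eq: "base_change k (gvar G) (?c V) P = D [^]\<^bsub>grp G (?c V)\<^esub> q"
      using div by blast
    have "base_change k (gvar H) (?c V) (f ?b P) = f (?c V) D [^]\<^bsub>grp H (?c V)\<^esub> q"
      using bc[OF fc P] hom_nat_pow[OF f[OF fc] D groups(1)[OF fc] groups(2)[OF fc]] eq by simp
    then show ?thesis
      using hom_in_carrier[OF f[OF fc] D] by blast
  qed
  then have "{V \<in> places k. \<not> (\<exists>D\<in>carrier (grp H (?c V)).
      base_change k (gvar H) (?c V) (f ?b P) = D [^]\<^bsub>grp H (?c V)\<^esub> q)} \<subseteq> ?A"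
    by blast
  then have "finite {V \<in> places k. \<not> (\<exists>D\<in>carrier (grp H (?c V)).
      base_change k (gvar H) (?c V) (f ?b P) = D [^]\<^bsub>grp H (?c V)\<^esub> q)}"
    using fin by (rule finite_subset)
  then obtain D where D: "D \<in> carrier (grp H ?b)" "f ?b P = D [^]\<^bsub>grp H ?b\<^esub> q"
    using H fP unfolding local_global_divisibility_def by blast
  have "g (f ?b P) = g D [^]\<^bsub>grp G ?b\<^esub> q"
    unfolding D(2) by (rule hom_nat_pow[OF g D(1) groups(2)[OF fb] groups(1)[OF fb]])
  then have "P = g D [^]\<^bsub>grp G ?b\<^esub> q"
    unfolding gf[OF P] .
  then show "\<exists>D\<in>carrier (grp G ?b). P = D [^]\<^bsub>grp G ?b\<^esub> q"
    using hom_in_carrier[OF g D(1)] by blast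
qed

section \<open>Divisibility of pairs and of neutral elements\<close>

context extension_field
begin

lemma base_change_Gm_one:
  "base_change k (Gm_var k) e \<one>\<^bsub>grp (Gm k) (base_extension k)\<^esub> = \<one>\<^bsub>grp (Gm k) e\<^esub>"
proof -
  interpret b: extension_field k "base_extension k"
    by unfold_locales (rule field_extension_K)
  show ?thesis
    using base_change_coord_vec[of "Gm_var k" "[\<one>\<^bsub>K\<^esub>, \<one>\<^bsub>K\<^esub>]"] torus_coords_hom_coords[OF b.torus_one]
    by (simp add: Gm_def Gm_var_def)
qed

lemma base_change_infinity_point:
  "base_change k (elliptic_var k W) e (infinity_point K) = infinity_point L"
  using base_change_coord_vec[of "elliptic_var k W" "[\<zero>\<^bsub>K\<^esub>, \<one>\<^bsub>K\<^esub>, \<zero>\<^bsub>K\<^esub>]"] K.infinity_hom_coords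
  by (simp add: infinity_point_def elliptic_var_def numeral_2_eq_2)

end

lemma (in commutative_semidirect) pair_divisible_iff:
  assumes "g \<in> carrier N" "P \<in> carrier H"
  shows "(\<exists>D\<in>carrier M. pair g P = D [^]\<^bsub>M\<^esub> (n::nat)) \<longleftrightarrow>
    (\<exists>d\<in>carrier N. g = d [^]\<^bsub>N\<^esub> n) \<and> (\<exists>D\<in>carrier H. P = D [^]\<^bsub>H\<^esub> n)"
proof
  assume "\<exists>D\<in>carrier M. pair g P = D [^]\<^bsub>M\<^esub> n"
  then obtain d D where dD: "d \<in> carrier N" "D \<in> carrier H" and eq: "pair g P = pair d D [^]\<^bsub>M\<^esub> n"
    unfolding carrier_M by blast
  note projections' = projections[OF N.nat_pow_closed[OF dD(1)] pow_closed[OF dD(2)]]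
  have "g = p1 (pair d D [^]\<^bsub>M\<^esub> n)" "P = p2 (pair d D [^]\<^bsub>M\<^esub> n)"
    using projections[OF assms] unfolding eq by simp_all
  then show "(\<exists>d\<in>carrier N. g = d [^]\<^bsub>N\<^esub> n) \<and> (\<exists>D\<in>carrier H. P = D [^]\<^bsub>H\<^esub> n)"
    unfolding pow_pair[OF dD] projections' using dD by blast
next
  assume "(\<exists>d\<in>carrier N. g = d [^]\<^bsub>N\<^esub> n) \<and> (\<exists>D\<in>carrier H. P = D [^]\<^bsub>H\<^esub> n)"
  then obtain d D where dD: "d \<in> carrier N" "D \<in> carrier H"
    and eq: "g = d [^]\<^bsub>N\<^esub> n" "P = D [^]\<^bsub>H\<^esub> n"
    by blast
  show "\<exists>D\<in>carrier M. pair g P = D [^]\<^bsub>M\<^esub> n"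
    unfolding eq pow_pair[OF dD, symmetric] using pair_mem[OF dD] by blast
qed

definition divisible_over :: "'a ring \<Rightarrow> 'a alg_group \<Rightarrow> nat \<Rightarrow> 'a point \<Rightarrow> 'a extension \<Rightarrow> bool" where
  "divisible_over k H q P e \<longleftrightarrow>
     (\<exists>D\<in>carrier (grp H e). base_change k (gvar H) e P = D [^]\<^bsub>grp H e\<^esub> q)"

lemma local_global_divisibility_iff:
  "local_global_divisibility k H q \<longleftrightarrow> (\<forall>P\<in>carrier (grp H (base_extension k)).
     finite {V \<in> places k. \<not> divisible_over k H q P (completion_extension k V)} \<longrightarrow>
     (\<exists>D\<in>carrier (grp H (base_extension k)). P = D [^]\<^bsub>grp H (base_extension k)\<^esub> q))"
  by (simp add: local_global_divisibility_def divisible_over_def)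

text \<open>The places where a pair is not divisible are those of its components taken together. A
  neutral element contributes none: its base change is neutral and thus its own \<open>q\<close>-th
  power. Hence (g, 0) has the same bad places as \<open>g\<close>, and (1, P) the same as
  \<open>P\<close>, so finiteness passes in both directions.\<close>

lemma local_global_divisibility_semidirect:
  fixes k :: "'a ring" and W :: "'a weierstrass"
  assumes "field k"
    and semidirect: "\<And>e. field_extension k e \<Longrightarrow> commutative_semidirect k e W \<phi> (G e) (f e)"
  shows "local_global_divisibility k (semidirect_product k (Gm k) (elliptic_group k W) \<phi>) q \<longleftrightarrow>
    local_global_divisibility k (Gm k) q \<and> local_global_divisibility k (elliptic_group k W) q"
    (is "local_global_divisibility k ?M q \<longleftrightarrow>
      local_global_divisibility k ?N q \<and> local_global_divisibility k ?H q")
proof -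
  let ?b = "base_extension k" and ?c = "completion_extension k"
  interpret b: commutative_semidirect k ?b W \<phi> "G ?b" "f ?b"
    by (rule semidirect[OF field_extension_base[OF assms(1)]])
  let ?bad = "\<lambda>H P. {V \<in> places k. \<not> divisible_over k H q P (?c V)}"
  have div_pair: "divisible_over k ?M q (b.pair g P) e \<longleftrightarrow>
      divisible_over k ?N q g e \<and> divisible_over k ?H q P e"
    if "field_extension k e" and g: "g \<in> carrier (grp ?N ?b)" and P: "P \<in> carrier (grp ?H ?b)" for e g P
  proof -
    interpret c: commutative_semidirect k e W \<phi> "G e" "f e"
      by (rule semidirect) fact
    have g': "g \<in> var_points k (Gm_var k) ?b" and P': "P \<in> var_points k (elliptic_var k W) ?b"
      using g P by (simp_all add: carrier_Gm_var_points)
    have "base_change k (Gm_var k) e g \<in> carrier c.N"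
      "base_change k (elliptic_var k W) e P \<in> carrier c.H"
      using c.base_change_closed[OF poly_variety_Gm[OF assms(1)] g']
        c.base_change_closed[OF poly_variety_elliptic[OF assms(1) b.elliptic] P']
      by (simp_all add: carrier_Gm_var_points)
    from c.pair_divisible_iff[OF this] show ?thesis
      by (simp only: divisible_over_def gvar_simps c.base_change_pair_point[OF g' P'])
  qed
  have bad_pair: "?bad ?M (b.pair g P) = ?bad ?N g \<union> ?bad ?H P"
    if "g \<in> carrier (grp ?N ?b)" "P \<in> carrier (grp ?H ?b)" for g P
  proof (rule Set.set_eqI)
    fix V show "V \<in> ?bad ?M (b.pair g P) \<longleftrightarrow> V \<in> ?bad ?N g \<union> ?bad ?H P"
      using div_pair[OF field_extension_completion[OF assms(1)] that, of V] by (cases "V \<in> places k") simp_all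
  qed
  have "divisible_over k ?N q \<one>\<^bsub>grp ?N ?b\<^esub> e" "divisible_over k ?H q (infinity_point (fst ?b)) e"
    if "field_extension k e" for e
  proof -
    interpret c: commutative_semidirect k e W \<phi> "G e" "f e"
      by (rule semidirect) fact
    have "base_change k (gvar ?N) e \<one>\<^bsub>grp ?N ?b\<^esub> = \<one>\<^bsub>c.N\<^esub> [^]\<^bsub>c.N\<^esub> q"
      by (simp only: gvar_simps c.base_change_Gm_one c.N.nat_pow_one)
    then show "divisible_over k ?N q \<one>\<^bsub>grp ?N ?b\<^esub> e"
      unfolding divisible_over_def using c.N.one_closed by blast
    have "base_change k (gvar ?H) e (infinity_point (fst ?b)) = infinity_point (fst e) [^]\<^bsub>c.H\<^esub> q"
      by (simp only: gvar_simps c.base_change_infinity_point c.pow_infinity)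
    then show "divisible_over k ?H q (infinity_point (fst ?b)) e"
      unfolding divisible_over_def using c.infinity_mem by blast
  qed
  note div_one = this[OF field_extension_completion[OF assms(1)]]
  have bad_one: "?bad ?N \<one>\<^bsub>grp ?N ?b\<^esub> = {}" "?bad ?H (infinity_point (fst ?b)) = {}"
    by (simp_all add: div_one cong: conj_cong)
  show ?thesis
  proof (intro iffI conjI)
    assume M: "local_global_divisibility k ?M q"
    show "local_global_divisibility k ?N q"
      unfolding local_global_divisibility_iff
    proof (intro ballI impI)
      fix g assume g: "g \<in> carrier (grp ?N ?b)" "finite (?bad ?N g)"
      have "finite (?bad ?M (b.pair g (infinity_point (fst ?b))))"
        unfolding bad_pair[OF g(1) b.infinity_mem] bad_one using g(2) by simp
      then have "\<exists>D\<in>carrier b.M. b.pair g (infinity_point (fst ?b)) = D [^]\<^bsub>b.M\<^esub> q"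
        using M b.pair_mem[OF g(1) b.infinity_mem] unfolding local_global_divisibility_iff by blast
      then show "\<exists>d\<in>carrier (grp ?N ?b). g = d [^]\<^bsub>grp ?N ?b\<^esub> q"
        unfolding b.pair_divisible_iff[OF g(1) b.infinity_mem] ..
    qed
    show "local_global_divisibility k ?H q"
      unfolding local_global_divisibility_iff
    proof (intro ballI impI)
      fix P assume P: "P \<in> carrier (grp ?H ?b)" "finite (?bad ?H P)"
      have "finite (?bad ?M (b.pair \<one>\<^bsub>grp ?N ?b\<^esub> P))"
        unfolding bad_pair[OF b.N.one_closed P(1)] bad_one using P(2) by simp
      then have "\<exists>D\<in>carrier b.M. b.pair \<one>\<^bsub>grp ?N ?b\<^esub> P = D [^]\<^bsub>b.M\<^esub> q"
        using M b.pair_mem[OF b.N.one_closed P(1)] unfolding local_global_divisibility_iff by blast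
      then show "\<exists>D\<in>carrier (grp ?H ?b). P = D [^]\<^bsub>grp ?H ?b\<^esub> q"
        unfolding b.pair_divisible_iff[OF b.N.one_closed P(1)] ..
    qed
  next
    assume NH: "local_global_divisibility k ?N q \<and> local_global_divisibility k ?H q"
    show "local_global_divisibility k ?M q"
      unfolding local_global_divisibility_iff
    proof (intro ballI impI)
      fix R assume "R \<in> carrier b.M" and fin: "finite (?bad ?M R)"
      then obtain g P where R: "R = b.pair g P" and gP: "g \<in> carrier (grp ?N ?b)" "P \<in> carrier (grp ?H ?b)"
        unfolding b.carrier_M by blast
      have "finite (?bad ?N g)" "finite (?bad ?H P)"
        using fin unfolding R bad_pair[OF gP] by simp_all
      then show "\<exists>D\<in>carrier b.M. R = D [^]\<^bsub>b.M\<^esub> q"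
        unfolding R b.pair_divisible_iff[OF gP]
        using NH gP unfolding local_global_divisibility_iff by blast
    qed
  qed
qed

theorem theorem7p1:
  fixes k :: "'a ring" and G :: "'a alg_group" and W :: "'a weierstrass"
    and \<phi> :: "'a extension \<Rightarrow> 'a point \<Rightarrow> 'a point \<Rightarrow> 'a point"
    and p l q :: nat
  assumes "number_field k"
    and "Factorial_Ring.prime p" and "l > 0" and "q = p ^ l"
    and "commutative_algebraic_group k G"
    and "elliptic_curve k W"
    and "hom_to_Aut_Gm k (elliptic_group k W) \<phi>"
    and "isomorphic_over k G (semidirect_product k (Gm k) (elliptic_group k W) \<phi>)"
  shows "local_global_divisibility k G q \<longleftrightarrow>
    local_global_divisibility k (Gm k) q \<and>
    local_global_divisibility k (elliptic_group k W) q"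
proof -
  let ?M = "semidirect_product k (Gm k) (elliptic_group k W) \<phi>" and ?b = "base_extension k"
  have k: "field k"
    using assms(1) by (simp add: number_field_def)
  obtain f g where f: "regular_map k (gvar G) (gvar ?M) f" and g: "regular_map k (gvar ?M) (gvar G) g"
    and fg: "\<forall>e. field_extension k e \<longrightarrow> f e \<in> hom (grp G e) (grp ?M e) \<and>
        (\<forall>P\<in>var_points k (gvar G) e. g e (f e P) = P) \<and>
        (\<forall>Q\<in>var_points k (gvar ?M) e. f e (g e Q) = Q)"
    using assms(8) unfolding isomorphic_over_def by blast
  have hom: "f e \<in> hom (grp G e) (grp ?M e)" if "field_extension k e" for e
    by (rule conjunct1[OF mp[OF spec[OF fg] that]])
  note G' = assms(5)[unfolded commutative_algebraic_group_def algebraic_group_def]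
  have G: "comm_group (grp G e)" "carrier (grp G e) = var_points k (gvar G) e"
    if "field_extension k e" for e
    using mp[OF spec[OF conjunct2[OF G']] that]
      mp[OF spec[OF conjunct1[OF conjunct2[OF conjunct1[OF G']]]] that] by simp_all
  have M: "carrier (grp ?M e) = var_points k (gvar ?M) e" for e
    by (simp add: semidirect_product_simps)
  have g_closed: "g e Q \<in> carrier (grp G e)"
    if e: "field_extension k e" and Q: "Q \<in> carrier (grp ?M e)" for e Q
  proof -
    have "g e ` var_points k (gvar ?M) e \<subseteq> var_points k (gvar G) e"
      by (rule mp[OF spec[OF conjunct1[OF g[unfolded regular_map_def]]] e])
    then show ?thesis
      using Q unfolding M G(2)[OF e] by (rule subsetD[OF _ imageI])
  qed
  have gf: "g e (f e P) = P" if e: "field_extension k e" and P: "P \<in> carrier (grp G e)" for e P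
    using mp[OF spec[OF fg] e] P[unfolded G(2)[OF e]] by simp
  have fg': "f e (g e Q) = Q" if e: "field_extension k e" and Q: "Q \<in> carrier (grp ?M e)" for e Q
    using mp[OF spec[OF fg] e] Q[unfolded M] by simp
  have iso: "f e \<in> iso (grp G e) (grp ?M e)" if "field_extension k e" for e
    unfolding iso_def
  proof (intro CollectI conjI hom[OF that] bij_betw_byWitness[where f' = "g e"])
    show "\<forall>P\<in>carrier (grp G e). g e (f e P) = P" "\<forall>Q\<in>carrier (grp ?M e). f e (g e Q) = Q"
      using gf[OF that] fg'[OF that] by simp_all
    show "f e ` carrier (grp G e) \<subseteq> carrier (grp ?M e)" "g e ` carrier (grp ?M e) \<subseteq> carrier (grp G e)"
      using hom_in_carrier[OF hom[OF that]] g_closed[OF that] by (simp_all add: image_subset_iff)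
  qed
  have semidirect: "commutative_semidirect k e W \<phi> (grp G e) (f e)" if "field_extension k e" for e
  proof -
    have "\<phi> e \<in> hom (grp (elliptic_group k W) e) (Aut_Gm k e)"
      by (rule mp[OF spec[OF conjunct1[OF assms(7)[unfolded hom_to_Aut_Gm_def]]] that])
    then show ?thesis
      using k that assms(6) G(1)[OF that] iso[OF that]
      by (simp add: commutative_semidirect_def commutative_semidirect_axioms_def extension_field_def
        extension_field_axioms_def)
  qed
  have groups: "group (grp G e)" "group (grp ?M e)" if "field_extension k e" for e
    using G(1)[OF that] commutative_semidirect.comm_group_M[OF semidirect[OF that]]
    by (simp_all add: comm_group.axioms(2))
  \<comment> \<open>\<open>isomorphic_over\<close> states multiplicativity for \<open>f\<close>. For
    its inverse it follows by applying \<open>g e\<close> to the equation that \<open>f e\<close>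
    maps the product of \<open>g e Q\<close> and \<open>g e Q'\<close> to the product of
    \<open>Q\<close> and \<open>Q'\<close>.\<close>
  have hom': "g e \<in> hom (grp ?M e) (grp G e)" if e: "field_extension k e" for e
  proof (rule homI)
    fix Q Q' assume Q: "Q \<in> carrier (grp ?M e)" "Q' \<in> carrier (grp ?M e)"
    have "g e (f e (g e Q \<otimes>\<^bsub>grp G e\<^esub> g e Q')) = g e Q \<otimes>\<^bsub>grp G e\<^esub> g e Q'"
      using groups(1)[OF e] Q by (intro gf e) (simp add: group.is_monoid monoid.m_closed g_closed[OF e])
    moreover have "f e (g e Q \<otimes>\<^bsub>grp G e\<^esub> g e Q') = Q \<otimes>\<^bsub>grp ?M e\<^esub> Q'"
      using hom_mult[OF hom[OF e] g_closed[OF e Q(1)] g_closed[OF e Q(2)]] fg'[OF e] Q by simp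
    ultimately show "g e (Q \<otimes>\<^bsub>grp ?M e\<^esub> Q') = g e Q \<otimes>\<^bsub>grp G e\<^esub> g e Q'"
      by simp
  qed (rule g_closed[OF e])
  note b = field_extension_base[OF k]
  have "poly_variety k (gvar G)"
    using poly_variety_is_variety[OF k] G' by blast
  then have bc_f: "f e (base_change k (gvar G) e P) = base_change k (gvar ?M) e (f ?b P)"
    if "field_extension k e" "P \<in> carrier (grp G ?b)" for e P
    using that k f G(2)[OF b]
    by (intro extension_field.base_change_regular_map)
      (simp_all add: extension_field_def extension_field_axioms_def)
  have "poly_variety k (gvar ?M)"
    using poly_variety_prod[OF k poly_variety_Gm[OF k] poly_variety_elliptic[OF k assms(6)]] by simp
  then have bc_g: "g e (base_change k (gvar ?M) e Q) = base_change k (gvar G) e (g ?b Q)"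
    if "field_extension k e" "Q \<in> carrier (grp ?M ?b)" for e Q
    using that k g M
    by (intro extension_field.base_change_regular_map)
      (simp_all add: extension_field_def extension_field_axioms_def)
  \<comment> \<open>Both implications are instances of the same transfer, with \<open>f\<close> and
    \<open>g\<close> exchanged; \<open>bc_f\<close> and \<open>bc_g\<close> hold because both are
    regular maps over \<open>k\<close>.\<close>
  have "local_global_divisibility k G q \<longleftrightarrow> local_global_divisibility k ?M q"
  proof
    assume "local_global_divisibility k ?M q"
    with k groups hom hom'[OF b] gf[OF b] bc_f show "local_global_divisibility k G q"
      by (rule local_global_divisibility_transfer)
  next
    assume "local_global_divisibility k G q"
    with k groups(2,1) hom' hom[OF b] fg'[OF b] bc_g show "local_global_divisibility k ?M q"
      by (rule local_global_divisibility_transfer)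
  qed
  then show ?thesis
    using local_global_divisibility_semidirect[OF k semidirect] by simp
qed

end
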